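(* Let $A$ and $B$ be positive trace class operators on a Hilbert space. For every real $\nu$ with $0\le\nu\le 1$, $$\operatorname{Tr}[B^2]\,\big(\operatorname{Tr}[A^{1+\nu}B^{1-\nu}]\big)^2\ \ge\ \operatorname{Tr}[A^{2\nu}B^{2(1-\nu)}]\,\big(\operatorname{Tr}[AB]\big)^2 .$$
   Context: "Positive" means self-adjoint and positive semidefinite. Powers of positive operators are defined by functional calculus, with the convention $X^0=I$ (the identity operator). *)

theory Defs
  imports
    "HOL-Analysis.Analysis"
    "HOL-Computational_Algebra.Polynomial"
    "HOL-Library.Complex_Order"
begin

text \<open>
  A complex inner product space is a real inner product space with a compatible complex
  structure: the real inner product is the real part of the complex one, so both induce the same
  norm. The complex inner product is conjugate-linear in its first argument.
\<close>

class complex_hilbert = real_inner + complete_space +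
  fixes scaleC :: "complex \<Rightarrow> 'a \<Rightarrow> 'a" (infixr \<open>*\<^sub>C\<close> 75)
    and cinner :: "'a \<Rightarrow> 'a \<Rightarrow> complex"
  assumes scaleC_add_right: "a *\<^sub>C (x + y) = a *\<^sub>C x + a *\<^sub>C y"
    and scaleC_add_left: "(a + b) *\<^sub>C x = a *\<^sub>C x + b *\<^sub>C x"
    and scaleC_scaleC: "a *\<^sub>C b *\<^sub>C x = (a * b) *\<^sub>C x"
    and scaleC_of_real: "complex_of_real r *\<^sub>C x = r *\<^sub>R x"
    and cinner_commute: "cinner x y = cnj (cinner y x)"
    and cinner_add_right: "cinner x (y + z) = cinner x y + cinner x z"
    and cinner_scaleC_right: "cinner x (a *\<^sub>C y) = a * cinner x y"
    and Re_cinner: "Re (cinner x y) = inner x y"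

instantiation complex :: complex_hilbert
begin

definition scaleC_complex_def: "scaleC (a::complex) (x::complex) = a * x"

definition cinner_complex_def: "cinner (x::complex) y = cnj x * y"

instance
  by standard
    (auto simp: scaleC_complex_def cinner_complex_def scaleR_conv_of_real inner_complex_def
      algebra_simps)

end

text \<open>
  Operators are elements of the library type of bounded real-linear maps (which carries the
  operator norm), with complex linearity as a predicate.
\<close>

definition complex_linear_op :: "('a::complex_hilbert \<Rightarrow>\<^sub>L 'a) \<Rightarrow> bool" where
  "complex_linear_op T \<longleftrightarrow>
     (\<forall>c x. blinfun_apply T (c *\<^sub>C x) = c *\<^sub>C blinfun_apply T x)"

definition adj_op :: "('a::complex_hilbert \<Rightarrow>\<^sub>L 'a) \<Rightarrow> ('a \<Rightarrow>\<^sub>L 'a)" where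
  "adj_op T = (THE S. \<forall>x y. cinner (blinfun_apply S x) y = cinner x (blinfun_apply T y))"

definition selfadjoint_op :: "('a::complex_hilbert \<Rightarrow>\<^sub>L 'a) \<Rightarrow> bool" where
  "selfadjoint_op T \<longleftrightarrow> complex_linear_op T \<and>
     (\<forall>x y. cinner (blinfun_apply T x) y = cinner x (blinfun_apply T y))"

text \<open>
  Inequalities between complex numbers refer to the order of \<open>Complex_Order\<close>; in particular
  \<open>0 \<le> z\<close> says that \<open>z\<close> is real and nonnegative.
\<close>

definition positive_op :: "('a::complex_hilbert \<Rightarrow>\<^sub>L 'a) \<Rightarrow> bool" where
  "positive_op T \<longleftrightarrow> selfadjoint_op T \<and> (\<forall>x. 0 \<le> cinner x (blinfun_apply T x))"

text \<open>The absolute value \<open>|T|\<close>, the unique positive square root of \<open>T\<^sup>* T\<close>.\<close>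

definition abs_op :: "('a::complex_hilbert \<Rightarrow>\<^sub>L 'a) \<Rightarrow> ('a \<Rightarrow>\<^sub>L 'a)" where
  "abs_op T = (THE P. positive_op P \<and> P o\<^sub>L P = adj_op T o\<^sub>L T)"

definition is_onb :: "'a::complex_hilbert set \<Rightarrow> bool" where
  "is_onb E \<longleftrightarrow>
     (\<forall>e\<in>E. norm e = 1) \<and>
     (\<forall>e\<in>E. \<forall>f\<in>E. e \<noteq> f \<longrightarrow> cinner e f = 0) \<and>
     (\<forall>x. (\<forall>e\<in>E. cinner e x = 0) \<longrightarrow> x = 0)"

definition trace_class :: "('a::complex_hilbert \<Rightarrow>\<^sub>L 'a) \<Rightarrow> bool" where
  "trace_class T \<longleftrightarrow> complex_linear_op T \<and>
     (\<exists>E. is_onb E \<and> (\<lambda>e. cinner e (blinfun_apply (abs_op T) e)) summable_on E)"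

text \<open>
  The trace is computed in an arbitrary orthonormal basis; for trace class operators the sum
  converges absolutely and does not depend on the basis.
\<close>

definition trace_op :: "('a::complex_hilbert \<Rightarrow>\<^sub>L 'a) \<Rightarrow> complex" where
  "trace_op T = (\<Sum>\<^sub>\<infinity>e\<in>(SOME E. is_onb E). cinner e (blinfun_apply T e))"

definition spectrum_op :: "('a::complex_hilbert \<Rightarrow>\<^sub>L 'a) \<Rightarrow> complex set" where
  "spectrum_op T = {z. \<not> (\<exists>R. complex_linear_op R \<and>
     (\<forall>x. blinfun_apply R (blinfun_apply T x - z *\<^sub>C x) = x) \<and>
     (\<forall>x. blinfun_apply T (blinfun_apply R x) - z *\<^sub>C blinfun_apply R x = x))}"

definition poly_op :: "real poly \<Rightarrow> ('a::complex_hilbert \<Rightarrow>\<^sub>L 'a) \<Rightarrow> ('a \<Rightarrow>\<^sub>L 'a)" where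
  "poly_op p T = (\<Sum>i\<le>degree p. coeff p i *\<^sub>R (((o\<^sub>L) T ^^ i) id_blinfun))"

text \<open>
  Continuous functional calculus of a self-adjoint operator \<open>T\<close>, for \<open>f\<close> continuous on the (real)
  spectrum of \<open>T\<close>: \<open>f(T)\<close> is the operator norm limit of \<open>q\<^sub>n(T)\<close> for every sequence of
  real polynomials \<open>q\<^sub>n\<close> that converges to \<open>f\<close> uniformly on the spectrum.
\<close>

definition fun_calc :: "(real \<Rightarrow> real) \<Rightarrow> ('a::complex_hilbert \<Rightarrow>\<^sub>L 'a) \<Rightarrow> ('a \<Rightarrow>\<^sub>L 'a)" where
  "fun_calc f T = (THE X. \<forall>q :: nat \<Rightarrow> real poly.
     uniform_limit {t. complex_of_real t \<in> spectrum_op T} (\<lambda>n. poly (q n)) f sequentially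
       \<longrightarrow> (\<lambda>n. poly_op (q n) T) \<longlonglongrightarrow> X)"

text \<open>
  Powers of a positive operator with real exponent \<open>s \<ge> 0\<close>. The exponent \<open>0\<close> is separate because
  \<open>0 powr 0 = 0\<close>; for \<open>s > 0\<close> the function \<open>\<lambda>t. t powr s\<close> is continuous on the nonnegative reals
  and vanishes at \<open>0\<close>.
\<close>

definition op_power :: "('a::complex_hilbert \<Rightarrow>\<^sub>L 'a) \<Rightarrow> real \<Rightarrow> ('a \<Rightarrow>\<^sub>L 'a)" where
  "op_power T s = (if s = 0 then id_blinfun else fun_calc (\<lambda>t. t powr s) T)"

end

(*
  A positive trace class operator is compact, hence diagonal in an orthonormal basis. If a_e and
  b_f are the eigenvalues of A and B, the trace of A^s B^t is the sum of
  a_e^s b_f^t |<e,f>|^2 over all pairs (e, f). The claim is then a consequence of Hoelder's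
  inequality; in additive form, Young's inequality with a parameter c > 0 bounds ab and
  a^(2v) b^(2(1-v)) by combinations of a^(1+v) b^(1-v) and b^2, these bounds are summed over all
  pairs, and c is chosen such that c^(1+v) Tr[A^(1+v) B^(1-v)] = Tr[B^2].
*)

theory Submission
  imports Defs
begin

section \<open>Orthonormal expansions\<close>

text \<open>Write P = Tr[A^(1+v) B^(1-v)] and m = Tr[B^2]. Hoelder's inequality for the weights
  |<e,f>|^2 gives Tr[AB] <= P^(1/(1+v)) m^(v/(1+v)) and Tr[A^(2v) B^(2(1-v))] <= P^(2v/(1+v))
  m^((1-v)/(1+v)). The square of the first bound times the second has total exponent 2 for P and 1
  for m, which is the claim. Here Tr[B^2] is read as Tr[A^0 B^2], so that all four traces are sums
  over the same pairs. In each product some exponent is at least 1, even for A^(2v) B^(2(1-v)),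
  since 2v + 2(1-v) = 2; the eigenvalues of that factor are summable while those of the other may be
  merely bounded. The definitions shape the rest: absolute value and functional calculus are
  definite descriptions, and the trace is computed in one unspecified basis. Hence uniqueness of the
  positive square root, uniqueness of the limit of polynomials, and agreement of the trace with its
  expansion in an eigenbasis have to be established.\<close>

lemma cinner_scaleC_left: "cinner (a *\<^sub>C x) y = cnj a * cinner x y"
  using cinner_commute cinner_scaleC_right complex_cnj_mult by metis

lemma cinner_scaleR_right: "cinner x (r *\<^sub>R y) = of_real r * cinner x y"
  by (simp flip: scaleC_of_real add: cinner_scaleC_right)

lemma cinner_scaleR_left: "cinner (r *\<^sub>R x) y = of_real r * cinner x y"
  by (simp flip: scaleC_of_real add: cinner_scaleC_left)

lemma cinner_zero_right [simp]: "cinner x 0 = 0"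
  using cinner_scaleR_right[of x 0 0] by simp

lemma cinner_zero_left [simp]: "cinner 0 x = 0"
  using cinner_scaleR_left[of 0 0 x] by simp

lemma cinner_minus_right: "cinner x (- y) = - cinner x y"
  using cinner_scaleR_right[of x "-1" y] by simp

lemma cinner_diff_right: "cinner x (y - z) = cinner x y - cinner x z"
  using cinner_add_right[of x y "- z"] by (simp add: cinner_minus_right)

lemma cinner_diff_left: "cinner (x - y) z = cinner x z - cinner y z"
  using cinner_commute cinner_diff_right complex_cnj_diff by metis

lemma cinner_self: "cinner x x = of_real ((norm x)\<^sup>2)"
proof (rule complex_eqI)
  show "Re (cinner x x) = Re (of_real ((norm x)\<^sup>2))"
    by (simp add: Re_cinner power2_norm_eq_inner)
  show "Im (cinner x x) = Im (of_real ((norm x)\<^sup>2))"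
    using arg_cong[OF cinner_commute[of x x], of Im] by simp
qed

lemma norm_scaleC: "norm (a *\<^sub>C x) = cmod a * norm x"
proof -
  have "complex_of_real ((norm (a *\<^sub>C x))\<^sup>2) = cnj a * a * of_real ((norm x)\<^sup>2)"
    by (simp add: cinner_self[symmetric] cinner_scaleC_left cinner_scaleC_right del: of_real_power)
  also have "cnj a * a = complex_of_real ((cmod a)\<^sup>2)"
    by (metis complex_norm_square mult.commute)
  finally have "(norm (a *\<^sub>C x))\<^sup>2 = (cmod a * norm x)\<^sup>2"
    by (metis of_real_eq_iff of_real_mult power_mult_distrib)
  then show ?thesis by simp
qed

lemma norm_cinner_le: "cmod (cinner x y) \<le> norm x * norm y"
proof (cases "cinner x y = 0")
  case False
  \<comment> \<open>A phase that turns \<open>cinner x y\<close> into its modulus; the real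
    Cauchy-Schwarz inequality then applies to \<open>x\<close> and
    \<open>c *\<^sub>C y\<close>.\<close>
  define c where "c = cnj (cinner x y) / cmod (cinner x y)"
  have c: "cmod c = 1" using False by (simp add: c_def norm_divide)
  have "cinner x (c *\<^sub>C y) = of_real (cmod (cinner x y))"
    using False by (simp add: cinner_scaleC_right c_def complex_norm_square[symmetric]
      power2_eq_square
        mult.commute field_simps flip: of_real_mult)
  then have "inner x (c *\<^sub>C y) = cmod (cinner x y)"
    by (metis Re_cinner Re_complex_of_real)
  then show ?thesis
    using norm_cauchy_schwarz[of x "c *\<^sub>C y"] by (simp add: norm_scaleC c)
qed simp

lemma bounded_linear_cinner_right: "bounded_linear (cinner x)"
proof (rule bounded_linear_intro)
  show "cmod (cinner x y) \<le> norm y * norm x" for y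
    using norm_cinner_le[of x y] by (simp add: mult.commute)
qed (simp_all add: cinner_add_right cinner_scaleR_right scaleR_conv_of_real)

lemma cinner_sum_right: "cinner x (sum f F) = (\<Sum>i\<in>F. cinner x (f i))"
  using bounded_linear_cinner_right[of x] by (simp add: linear_sum bounded_linear.linear)

lemma cinner_sum_left: "cinner (sum f F) x = (\<Sum>i\<in>F. cinner (f i) x)"
  using cinner_commute cinner_sum_right cnj_sum by (metis (no_types, lifting) sum.cong)

lemma cinner_eq_0_iff: "cinner x x = 0 \<longleftrightarrow> x = 0"
  by (simp add: cinner_self)

section \<open>Orthonormal systems: Bessel, Riesz-Fischer and Parseval\<close>

definition orthonormal :: "'a::complex_hilbert set \<Rightarrow> bool" where
  "orthonormal E \<longleftrightarrow> (\<forall>e\<in>E. norm e = 1) \<and> (\<forall>e\<in>E. \<forall>f\<in>E. e \<noteq> f \<longrightarrow> cinner e f = 0)"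

lemma is_onb_imp_orthonormal: "is_onb E \<Longrightarrow> orthonormal E"
  by (simp add: is_onb_def orthonormal_def)

lemma cinner_orthonormal:
  "orthonormal E \<Longrightarrow> e \<in> E \<Longrightarrow> f \<in> E \<Longrightarrow> cinner e f = (if e = f then 1 else 0)"
  by (auto simp: orthonormal_def cinner_self)

lemma cinner_orthonormal_sum:
  assumes "orthonormal E" "finite F" "F \<subseteq> E" "e \<in> E"
  shows "cinner e (\<Sum>f\<in>F. c f *\<^sub>C f) = (if e \<in> F then c e else 0)"
proof -
  have "cinner e (\<Sum>f\<in>F. c f *\<^sub>C f) = (\<Sum>f\<in>F. if e = f then c e else 0)"
    unfolding cinner_sum_right
    using assms by (intro sum.cong) (auto simp: cinner_scaleC_right cinner_orthonormal)
  then show ?thesis using assms by (simp add: sum.delta')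
qed

lemma norm_orthonormal_sum:
  assumes "orthonormal E" "finite F" "F \<subseteq> E"
  shows "(norm (\<Sum>f\<in>F. c f *\<^sub>C f))\<^sup>2 = (\<Sum>f\<in>F. (cmod (c f))\<^sup>2)"
proof -
  have "complex_of_real ((norm (\<Sum>f\<in>F. c f *\<^sub>C f))\<^sup>2) = (\<Sum>e\<in>F. cnj (c e) * c e)"
    unfolding cinner_self[symmetric] cinner_sum_left using assms
    by (intro sum.cong) (auto simp: cinner_scaleC_left cinner_orthonormal_sum[OF assms])
  also have "\<dots> = of_real (\<Sum>f\<in>F. (cmod (c f))\<^sup>2)"
    by (simp add: complex_norm_square mult.commute del: of_real_power)
  finally show ?thesis using of_real_eq_iff by blast
qed

lemma norm_diff_projection:
  assumes "orthonormal E" "finite F" "F \<subseteq> E"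
  shows "(norm (x - (\<Sum>e\<in>F. cinner e x *\<^sub>C e)))\<^sup>2 = (norm x)\<^sup>2 - (\<Sum>e\<in>F. (cmod (cinner e x))\<^sup>2)"
proof -
  define p where "p = (\<Sum>f\<in>F. cinner f x *\<^sub>C f)"
  have p: "(norm p)\<^sup>2 = (\<Sum>f\<in>F. (cmod (cinner f x))\<^sup>2)"
    unfolding p_def by (rule norm_orthonormal_sum[OF assms])
  have "cinner p x = (\<Sum>f\<in>F. of_real ((cmod (cinner f x))\<^sup>2))"
    unfolding p_def cinner_sum_left
    by (intro sum.cong) (simp_all add: cinner_scaleC_left complex_norm_square mult.commute del:
      of_real_power)
  then have "cinner p x = of_real ((norm p)\<^sup>2)"
    by (simp add: p)
  then have "inner p x = (norm p)\<^sup>2"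
    by (metis Re_cinner Re_complex_of_real)
  then have "(norm (x - p))\<^sup>2 = (norm x)\<^sup>2 - (norm p)\<^sup>2"
    by (simp add: power2_norm_eq_inner inner_diff_left inner_diff_right inner_commute)
  then show ?thesis by (simp add: p p_def[symmetric])
qed

lemma Bessel_finite:
  assumes "orthonormal E" "finite F" "F \<subseteq> E"
  shows "(\<Sum>e\<in>F. (cmod (cinner e x))\<^sup>2) \<le> (norm x)\<^sup>2"
  using norm_diff_projection[OF assms, of x]
    zero_le_power2[of "norm (x - (\<Sum>e\<in>F. cinner e x *\<^sub>C e))"] by linarith

lemma Bessel_summable:
  assumes "orthonormal E"
  shows "(\<lambda>e. (cmod (cinner e x))\<^sup>2) summable_on E"
  by (rule nonneg_bounded_partial_sums_imp_summable_on[where C = "(norm x)\<^sup>2"])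
     (use Bessel_finite[OF assms] in \<open>auto intro!: eventually_finite_subsets_at_top_weakI\<close>)

text \<open>Riesz-Fischer. By Pythagoras the squared distance of two nested partial sums is a
  difference of partial sums of the squared coefficients, so the net of finite partial sums is
  Cauchy and completeness supplies its limit.\<close>

lemma orthonormal_series_summable:
  assumes E: "orthonormal E" and c: "(\<lambda>e. (cmod (c e))\<^sup>2) summable_on E"
  shows "(\<lambda>e. c e *\<^sub>C e) summable_on E"
proof -
  define S where "S = infsum (\<lambda>e. (cmod (c e))\<^sup>2) E"
  define g where "g F = (\<Sum>e\<in>F. c e *\<^sub>C e)" for F
  have "cauchy_filter (filtermap g (finite_subsets_at_top E))"
    unfolding cauchy_filter_metric_filtermap
  proof (intro allI impI)
    fix r :: real assume "r > 0"
    then have "\<exists>F0. finite F0 \<and> F0 \<subseteq> E \<and> dist (\<Sum>e\<in>F0. (cmod (c e))\<^sup>2) S \<le> (r / 3)\<^sup>2"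
      unfolding S_def by (intro infsum_finite_approximation c) auto
    then obtain F0 where F0: "finite F0" "F0 \<subseteq> E"
      "S - (\<Sum>e\<in>F0. (cmod (c e))\<^sup>2) \<le> (r / 3)\<^sup>2"
      by (force simp: dist_real_def)
    have near: "dist (g F) (g F0) \<le> r / 3" if F: "finite F" "F \<subseteq> E" "F0 \<subseteq> F" for F
    proof -
      have "(norm (g F - g F0))\<^sup>2 = (\<Sum>e\<in>F - F0. (cmod (c e))\<^sup>2)"
        unfolding g_def sum_diff[OF F(1,3), symmetric]
        using F by (intro norm_orthonormal_sum[OF E]) auto
      also have "\<dots> = (\<Sum>e\<in>F. (cmod (c e))\<^sup>2) - (\<Sum>e\<in>F0. (cmod (c e))\<^sup>2)"
        by (rule sum_diff[OF F(1,3)])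
      also have "\<dots> \<le> (r / 3)\<^sup>2"
        using finite_sum_le_infsum[OF c F(1,2)] F0(3) unfolding S_def by auto
      finally show ?thesis using \<open>r > 0\<close> by (simp add: dist_norm power2_le_iff_abs_le)
    qed
    show "\<exists>P. eventually P (finite_subsets_at_top E) \<and> (\<forall>F G. P F \<and> P G \<longrightarrow> dist (g F) (g G) < r)"
    proof (intro exI conjI allI impI)
      show "eventually (\<lambda>F. finite F \<and> F0 \<subseteq> F \<and> F \<subseteq> E) (finite_subsets_at_top E)"
        unfolding eventually_finite_subsets_at_top using F0 by blast
      fix F G assume "(finite F \<and> F0 \<subseteq> F \<and> F \<subseteq> E) \<and> (finite G \<and> F0 \<subseteq> G \<and> G \<subseteq> E)"
      then show "dist (g F) (g G) < r"
        using near[of F] near[of G] dist_triangle2[of "g F" "g G" "g F0"] \<open>r > 0\<close> by auto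
    qed
  qed
  moreover have "complete (UNIV :: 'a set)"
    by (simp add: complete_UNIV)
  ultimately obtain L where "(g \<longlongrightarrow> L) (finite_subsets_at_top E)"
    using complete_uniform[where S = "UNIV :: 'a set"]
    by (force simp: filterlim_def)
  then show ?thesis
    using summable_on_def has_sum_def g_def by (metis (no_types, lifting) ext)
qed

lemma has_sum_cinner_right: "(f has_sum s) S \<Longrightarrow> ((\<lambda>i. cinner x (f i)) has_sum cinner x s) S"
  using has_sum_bounded_linear[OF bounded_linear_cinner_right] by (auto simp: o_def)

lemma cinner_orthonormal_series:
  assumes E: "orthonormal E" and s: "((\<lambda>e. c e *\<^sub>C e) has_sum s) E" and e: "e \<in> E"
  shows "cinner e s = c e"
proof -
  have "((\<lambda>f. cinner e (c f *\<^sub>C f)) has_sum c e) E"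
    using E e by (intro has_sum_finite_neutralI[of "{e}" E])
       (auto simp: cinner_scaleC_right cinner_orthonormal)
  then show ?thesis using has_sum_cinner_right[OF s] has_sum_unique by blast
qed

lemma onb_eqI:
  assumes "is_onb E" "\<And>e. e \<in> E \<Longrightarrow> cinner e x = cinner e y"
  shows "x = y"
  using assms unfolding is_onb_def
  by (metis cinner_diff_right eq_iff_diff_eq_0)

text \<open>The series converges by Bessel and Riesz-Fischer; its limit has the same coefficients as
  \<open>x\<close>, and totality of the basis, the form in which \<open>is_onb\<close> is defined,
  identifies the two.\<close>

lemma onb_expansion:
  assumes "is_onb E"
  shows "((\<lambda>e. cinner e x *\<^sub>C e) has_sum x) E"
proof -
  have E: "orthonormal E" by (rule is_onb_imp_orthonormal[OF assms])
  obtain s where s: "((\<lambda>e. cinner e x *\<^sub>C e) has_sum s) E"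
    using orthonormal_series_summable[OF E Bessel_summable[OF E]] summable_on_def by blast
  have "s = x"
    by (rule onb_eqI[OF assms]) (rule cinner_orthonormal_series[OF E s])
  then show ?thesis using s by simp
qed

lemma Parseval_cinner:
  assumes "is_onb E"
  shows "((\<lambda>e. cinner x e * cinner e y) has_sum cinner x y) E"
  using has_sum_cinner_right[OF onb_expansion[OF assms], of x y]
  by (simp add: cinner_scaleC_right mult.commute)

lemma Parseval_norm:
  assumes "is_onb E"
  shows "((\<lambda>e. (cmod (cinner e x))\<^sup>2) has_sum (norm x)\<^sup>2) E"
proof -
  have "cinner x e * cinner e x = of_real ((cmod (cinner e x))\<^sup>2)" for e
    by (metis cinner_commute complex_norm_square mult.commute)
  then show ?thesis
    using Parseval_cinner[OF assms, of x x] unfolding cinner_self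
    by (simp only: has_sum_of_real_iff)
qed

section \<open>Positive operators\<close>

text \<open>\<open>K\<close> is the norm of \<open>D\<close> restricted to the invariant subspace
  \<open>N\<close>, and the unit vectors \<open>X n\<close> nearly attain it. Expanding the square
  gives |D^2 x - K^2 x|^2 <= K^2 (K^2 - |D x|^2), which tends to 0 along them. The statement
  concerns \<open>D\<close> applied twice because the sign of the extremal spectral value of
  \<open>D\<close> is unknown.\<close>

lemma symmetric_approximate_eigenvectors:
  fixes D :: "'a::real_inner \<Rightarrow>\<^sub>L 'a"
  assumes sym: "\<And>x y. inner (D x) y = inner x (D y)"
    and N: "subspace N" "\<And>x. x \<in> N \<Longrightarrow> D x \<in> N"
    and u: "u \<in> N" "D u \<noteq> 0"
  obtains K X where "K > 0" "\<And>n. X n \<in> N" "\<And>n. norm (X n) = 1"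
    "(\<lambda>n. D (D (X n)) - K\<^sup>2 *\<^sub>R X n) \<longlonglongrightarrow> 0"
proof -
  define S where "S = {norm (D x) | x. x \<in> N \<and> norm x = 1}"
  define K where "K = Sup S"
  have bdd: "bdd_above S"
  proof (rule bdd_aboveI)
    fix s assume "s \<in> S"
    then obtain x where "s = norm (D x)" "norm x = 1" by (auto simp: S_def)
    then show "s \<le> norm D" using norm_blinfun[of D x] by simp
  qed
  have normalized: "norm (D x) / norm x \<in> S" if "x \<in> N" "x \<noteq> 0" for x
  proof -
    have "(inverse (norm x)) *\<^sub>R x \<in> N" "norm (inverse (norm x) *\<^sub>R x) = 1"
      using that N(1) by (auto simp: subspace_scale)
    moreover have "norm (D (inverse (norm x) *\<^sub>R x)) = norm (D x) / norm x"
      by (simp add: blinfun.scaleR_right divide_inverse)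
    ultimately show ?thesis unfolding S_def mem_Collect_eq
      by (intro exI[of _ "inverse (norm x) *\<^sub>R x"]) auto
  qed
  have bound: "norm (D x) \<le> K * norm x" if "x \<in> N" for x
  proof (cases "x = 0")
    case False
    then show ?thesis
      using cSup_upper[OF normalized[OF that False] bdd] by (simp add: K_def field_simps)
  qed (simp add: blinfun.zero_right)
  have "u \<noteq> 0" using u(2) by (auto simp: blinfun.zero_right)
  then have ne: "S \<noteq> {}" using normalized[OF u(1)] by auto
  have K: "K > 0"
  proof (rule ccontr)
    assume "\<not> K > 0"
    then have "K * norm u \<le> 0" by (simp add: mult_nonpos_nonneg)
    moreover have "norm (D u) > 0" using u(2) by simp
    ultimately show False using bound[OF u(1)] by linarith
  qed
  have "\<exists>x. x \<in> N \<and> norm x = 1 \<and> K - inverse (real (Suc n)) < norm (D x)" for n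
  proof -
    have "K - inverse (real (Suc n)) < Sup S" unfolding K_def by simp
    then show ?thesis unfolding less_cSup_iff[OF ne bdd] by (auto simp: S_def)
  qed
  then obtain X where X: "\<And>n. X n \<in> N" "\<And>n. norm (X n) = 1"
    "\<And>n. K - inverse (real (Suc n)) < norm (D (X n))"
    by metis
  have DX: "(\<lambda>n. norm (D (X n))) \<longlonglongrightarrow> K"
  proof (rule tendsto_sandwich)
    show "(\<lambda>n. K - inverse (real (Suc n))) \<longlonglongrightarrow> K"
      using tendsto_diff[OF tendsto_const LIMSEQ_inverse_real_of_nat, of K] by simp
    show "\<forall>\<^sub>F n in sequentially. norm (D (X n)) \<le> K"
      using bound[OF X(1)] X(2) by simp
  qed (use X(3) in \<open>auto intro: less_imp_le always_eventually\<close>)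
  have est: "(norm (D (D (X n)) - K\<^sup>2 *\<^sub>R X n))\<^sup>2 \<le> K\<^sup>2 * (K\<^sup>2 - (norm (D (X n)))\<^sup>2)" for n
  proof -
    have "(norm (D (D (X n))))\<^sup>2 \<le> (K * norm (D (X n)))\<^sup>2"
      by (intro power_mono bound N X) auto
    moreover have "inner (D (D (X n))) (X n) = (norm (D (X n)))\<^sup>2"
      using sym[of "D (X n)" "X n"] by (simp add: power2_norm_eq_inner)
    then have "(norm (D (D (X n)) - K\<^sup>2 *\<^sub>R X n))\<^sup>2
        = (norm (D (D (X n))))\<^sup>2 - 2 * K\<^sup>2 * (norm (D (X n)))\<^sup>2 + K\<^sup>2 * K\<^sup>2"
      using X(2)[of n] unfolding power2_norm_eq_inner
      by (simp add: inner_diff_left inner_diff_right inner_commute[of "X n" "D (D (X n))"]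
          norm_eq_1 algebra_simps)
    ultimately show ?thesis by (simp add: power_mult_distrib algebra_simps)
  qed
  have "(\<lambda>n. K\<^sup>2 * (K\<^sup>2 - (norm (D (X n)))\<^sup>2)) \<longlonglongrightarrow> K\<^sup>2 * (K\<^sup>2 - K\<^sup>2)"
    by (intro tendsto_intros DX)
  then have lim0: "(\<lambda>n. K\<^sup>2 * (K\<^sup>2 - (norm (D (X n)))\<^sup>2)) \<longlonglongrightarrow> 0" by simp
  have "(\<lambda>n. (norm (D (D (X n)) - K\<^sup>2 *\<^sub>R X n))\<^sup>2) \<longlonglongrightarrow> 0"
    by (rule Lim_null_comparison[OF _ lim0]) (simp add: est)
  then have "(\<lambda>n. D (D (X n)) - K\<^sup>2 *\<^sub>R X n) \<longlonglongrightarrow> 0"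
    by (simp add: tendsto_norm_zero_iff)
  then show thesis using that K X by blast
qed

text \<open>
  For \<open>D = P - Q\<close> and \<open>S = P + Q\<close> the hypothesis gives \<open>D S + S D = 0\<close>, so an approximate
  eigenvector \<open>v\<close> of \<open>D\<close> has \<open>\<langle>v, S v\<rangle>\<close> small; but \<open>\<bar>\<langle>v, D v\<rangle>\<bar> \<le> \<langle>v, S v\<rangle>\<close> by positivity.
\<close>

lemma positive_sqrt_unique:
  fixes P Q :: "'a::real_inner \<Rightarrow>\<^sub>L 'a"
  assumes symP: "\<And>x y. inner (P x) y = inner x (P y)" and symQ: "\<And>x y. inner (Q x) y
    = inner x (Q y)"
    and posP: "\<And>x. 0 \<le> inner x (P x)" and posQ: "\<And>x. 0 \<le> inner x (Q x)"
    and eq: "\<And>x. P (P x) = Q (Q x)"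
  shows "P = Q"
proof (rule ccontr)
  assume "P \<noteq> Q"
  define D where "D = P - Q"
  define S where "S = P + Q"
  have Dx: "D x = P x - Q x" for x by (simp add: D_def blinfun.diff_left)
  have Sx: "S x = P x + Q x" for x by (simp add: S_def blinfun.add_left)
  have symD: "inner (D x) y = inner x (D y)" for x y
    by (simp add: Dx inner_diff_left inner_diff_right symP symQ)
  have "\<exists>u. D u \<noteq> 0"
    using \<open>P \<noteq> Q\<close> blinfun_eqI[of P Q] unfolding Dx by auto
  then obtain u where u: "D u \<noteq> 0" by blast
  obtain K X where K: "K > 0" and "\<And>n. X n \<in> UNIV" and X: "\<And>n. norm (X n) = 1"
    and lim: "(\<lambda>n. D (D (X n)) - K\<^sup>2 *\<^sub>R X n) \<longlonglongrightarrow> 0"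
    by (rule symmetric_approximate_eigenvectors[OF symD subspace_UNIV UNIV_I UNIV_I u]) (rule that)
  \<comment> \<open>The inner product is |P v|^2 - |Q v|^2 = <v, P^2 v> - <v, Q^2 v>.\<close>
  have anti: "inner (D v) (S v) = 0" for v
    using eq[of v] symP[of v "P v"] symQ[of v "Q v"]
    by (simp add: Dx Sx inner_diff_left inner_diff_right inner_add_left inner_add_right
        inner_commute[of "Q v" "P v"])
  \<comment> \<open>Quantitative form for an arbitrary real \<open>k\<close>: the residual
    \<open>r = D v - k v\<close> controls <v, S v> from above through \<open>anti\<close>, and from
    below through |<v, D v>| \<le> <v, S v>.\<close>
  have key: "k\<^sup>2 * norm v \<le> norm (D v - k *\<^sub>R v) * (norm S + \<bar>k\<bar>)" for v k
  proof (cases "v = 0")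
    case False
    define r where "r = D v - k *\<^sub>R v"
    have "inner r (S v) = - k * inner v (S v)"
      using anti[of v] by (simp add: r_def inner_diff_left)
    moreover have "\<bar>inner r (S v)\<bar> \<le> norm r * (norm S * norm v)"
      using Cauchy_Schwarz_ineq2[of r "S v"] norm_blinfun[of S v]
      by (meson mult_left_mono norm_ge_zero order_trans)
    moreover have "0 \<le> inner v (S v)" using posP[of v] posQ[of v] by (simp add: Sx inner_add_right)
    ultimately have 1: "\<bar>k\<bar> * inner v (S v) \<le> norm r * (norm S * norm v)"
      by (simp add: abs_mult)
    have "inner v (D v) = k * (norm v)\<^sup>2 + inner v r"
      by (simp add: r_def inner_diff_right power2_norm_eq_inner)
    moreover have "\<bar>inner v r\<bar> \<le> norm v * norm r" by (rule Cauchy_Schwarz_ineq2)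
    moreover have "\<bar>inner v (D v)\<bar> \<le> inner v (S v)"
      using posP[of v] posQ[of v] by (simp add: Sx Dx inner_add_right inner_diff_right)
    moreover have "\<bar>k\<bar> * (norm v)\<^sup>2 = \<bar>k * (norm v)\<^sup>2\<bar>" by (simp add: abs_mult)
    ultimately have 2: "\<bar>k\<bar> * (norm v)\<^sup>2 - norm v * norm r \<le> inner v (S v)" by linarith
    have "\<bar>k\<bar> * (\<bar>k\<bar> * (norm v)\<^sup>2 - norm v * norm r) \<le> norm r * (norm S * norm v)"
      using mult_left_mono[OF 2, of "\<bar>k\<bar>"] 1 by linarith
    then have "norm v * (k\<^sup>2 * norm v) \<le> norm v * (norm r * (norm S + \<bar>k\<bar>))"
      by (simp add: algebra_simps power2_eq_square)
    then show ?thesis using False by (simp add: r_def)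
  qed simp
  \<comment> \<open>Since D^2 - K^2 = (D - K)(D + K), the vectors \<open>y\<close> and
    \<open>z\<close> are trial vectors for the values \<open>K\<close> and \<open>- K\<close> with
    the same residual. They cannot both be small, because \<open>y - z\<close> has norm 2 K; this
    settles the unknown sign.\<close>
  have low: "K ^ 3 \<le> norm (D (D (X n)) - K\<^sup>2 *\<^sub>R X n) * (norm S + K)" for n
  proof -
    define y where "y = D (X n) + K *\<^sub>R X n"
    define z where "z = D (X n) - K *\<^sub>R X n"
    have r: "D y - K *\<^sub>R y = D (D (X n)) - K\<^sup>2 *\<^sub>R X n" "D z - (- K) *\<^sub>R z
      = D (D (X n)) - K\<^sup>2 *\<^sub>R X n"
      by (simp_all add: y_def z_def blinfun.add_right blinfun.diff_right blinfun.scaleR_right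
          algebra_simps power2_eq_square)
    have "K\<^sup>2 * norm y \<le> norm (D (D (X n)) - K\<^sup>2 *\<^sub>R X n) * (norm S + K)"
      using key[of K y] K unfolding r by simp
    moreover have "K\<^sup>2 * norm z \<le> norm (D (D (X n)) - K\<^sup>2 *\<^sub>R X n) * (norm S + K)"
      using key[of "- K" z] K unfolding r by simp
    ultimately have yz: "K\<^sup>2 * (norm y + norm z)
      \<le> 2 * (norm (D (D (X n)) - K\<^sup>2 *\<^sub>R X n) * (norm S + K))"
      by (simp add: distrib_left)
    have "y - z = (2 * K) *\<^sub>R X n" by (simp add: y_def z_def flip: scaleR_2 scaleR_scaleR)
    then have "2 * K \<le> norm y + norm z"
      using norm_triangle_ineq4[of y z] X[of n] K by simp
    then have "K\<^sup>2 * (2 * K) \<le> K\<^sup>2 * (norm y + norm z)" by (intro mult_left_mono) auto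
    with yz show ?thesis by (simp add: power2_eq_square power3_eq_cube)
  qed
  have "(\<lambda>n. norm (D (D (X n)) - K\<^sup>2 *\<^sub>R X n) * (norm S + K)) \<longlonglongrightarrow> 0"
    by (intro tendsto_mult_left_zero tendsto_norm_zero lim)
  then have "K ^ 3 \<le> 0" by (rule LIMSEQ_le_const) (use low in auto)
  then show False using K by (simp add: power3_eq_cube not_less[symmetric])
qed

text \<open>Factor T^2 - K^2 = (T + K)(T - K). Positivity makes T + K bounded below by K, so
  approximate eigenvectors of T^2 satisfy T x - K x \<rightarrow> 0. Compactness makes T x converge
  along a subsequence, hence x itself, and the limit is a unit eigenvector. Closedness keeps it in
  \<open>N\<close>.\<close>

lemma compact_positive_eigenvector:
  fixes T :: "'a::real_inner \<Rightarrow>\<^sub>L 'a"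
  assumes sym: "\<And>x y. inner (T x) y = inner x (T y)" and pos: "\<And>x. 0 \<le> inner x (T x)"
    and compact: "compact (closure (T ` cball 0 1))"
    and N: "subspace N" "closed N" "\<And>x. x \<in> N \<Longrightarrow> T x \<in> N"
    and u: "u \<in> N" "T u \<noteq> 0"
  obtains k v where "v \<in> N" "norm v = 1" "T v = k *\<^sub>R v"
proof -
  obtain K X where K: "K > 0" and X: "\<And>n. X n \<in> N" "\<And>n. norm (X n) = 1"
    and lim: "(\<lambda>n. T (T (X n)) - K\<^sup>2 *\<^sub>R X n) \<longlonglongrightarrow> 0"
    by (rule symmetric_approximate_eigenvectors[OF sym N(1,3) u]) blast+
  define z where "z n = T (X n) - K *\<^sub>R X n" for n
  have zn: "norm (z n) \<le> norm (T (T (X n)) - K\<^sup>2 *\<^sub>R X n) / K" for n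
  proof (cases "z n = 0")
    case False
    have r: "T (z n) + K *\<^sub>R z n = T (T (X n)) - K\<^sup>2 *\<^sub>R X n"
      by (simp add: z_def blinfun.diff_right blinfun.scaleR_right algebra_simps power2_eq_square)
    have "K * (norm (z n))\<^sup>2 \<le> inner (z n) (T (z n) + K *\<^sub>R z n)"
      using pos[of "z n"] by (simp add: inner_add_right power2_norm_eq_inner)
    also have "\<dots> \<le> norm (z n) * norm (T (z n) + K *\<^sub>R z n)" by (rule norm_cauchy_schwarz)
    finally have "norm (z n) * (K * norm (z n)) \<le> norm (z n) * norm (T (z n) + K *\<^sub>R z n)"
      by (simp add: power2_eq_square algebra_simps)
    then show ?thesis using False K r by (simp add: field_simps)
  qed (use K in simp)
  have zl: "(\<lambda>n. norm (T (T (X n)) - K\<^sup>2 *\<^sub>R X n) / K) \<longlonglongrightarrow> 0"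
    using tendsto_divide_zero[OF tendsto_norm_zero[OF lim]] by simp
  have z: "z \<longlonglongrightarrow> 0"
    by (rule Lim_null_comparison[OF _ zl]) (simp add: zn)
  have "T (X n) \<in> closure (T ` cball 0 1)" for n
    using X(2)[of n] closure_subset[of "T ` cball 0 1"] by (simp add: image_subset_iff)
  then obtain L r where r: "strict_mono (r :: nat \<Rightarrow> nat)" and L: "((\<lambda>n. T (X n)) \<circ> r) \<longlonglongrightarrow> L"
    using compact[unfolded compact_def, rule_format, of "\<lambda>n. T (X n)"] by blast
  have zr: "(z \<circ> r) \<longlonglongrightarrow> 0" by (rule LIMSEQ_subseq_LIMSEQ[OF z r])
  have "(\<lambda>n. inverse K *\<^sub>R (((\<lambda>n. T (X n)) \<circ> r) n - (z \<circ> r) n)) \<longlonglongrightarrow> inverse K *\<^sub>R (L - 0)"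
    by (intro tendsto_intros L zr)
  moreover have "inverse K *\<^sub>R (((\<lambda>n. T (X n)) \<circ> r) n - (z \<circ> r) n) = X (r n)" for n
    using K by (simp add: z_def)
  ultimately have Xr: "(\<lambda>n. X (r n)) \<longlonglongrightarrow> inverse K *\<^sub>R L" by simp
  define v where "v = inverse K *\<^sub>R L"
  have "v \<in> N"
    using closed_sequentially[OF N(2), of "\<lambda>n. X (r n)" v] X(1) Xr by (simp add: v_def)
  moreover have "norm v = 1"
    using tendsto_norm[OF Xr] unfolding X(2) v_def by (rule LIMSEQ_unique[OF _ tendsto_const])
  moreover have "(\<lambda>n. T (X (r n))) \<longlonglongrightarrow> T v"
    unfolding v_def by (intro blinfun.tendsto tendsto_const Xr)
  then have "T v = L" using LIMSEQ_unique L by (simp add: o_def)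
  then have "T v = K *\<^sub>R v" using K by (simp add: v_def)
  ultimately show thesis using that by blast
qed

section \<open>Absolute value of a positive operator\<close>

lemma positive_op_inner:
  assumes "positive_op T"
  shows "inner (T x) y = inner x (T y)" "0 \<le> inner x (T x)"
proof -
  show "inner (T x) y = inner x (T y)"
    using assms by (simp add: positive_op_def selfadjoint_op_def flip: Re_cinner)
  show "0 \<le> inner x (T x)"
    using assms by (simp add: positive_op_def less_eq_complex_def flip: Re_cinner)
qed

lemma adj_op_selfadjoint:
  assumes "selfadjoint_op T"
  shows "adj_op T = T"
  unfolding adj_op_def
proof (rule the_equality)
  show "\<forall>x y. cinner (T x) y = cinner x (T y)"
    using assms by (simp add: selfadjoint_op_def)
next
  fix S assume S: "\<forall>x y. cinner (blinfun_apply S x) y = cinner x (T y)"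
  have "cinner (S x - T x) (S x - T x) = 0" for x
    using S assms by (simp add: selfadjoint_op_def cinner_diff_left)
  then show "S = T" by (intro blinfun_eqI) (simp add: cinner_eq_0_iff)
qed

text \<open>\<open>T\<close> is its own adjoint and hence itself a positive square root of
  \<open>adj_op T o\<^sub>L T\<close>; uniqueness of such roots settles the description.\<close>

lemma abs_op_positive:
  assumes "positive_op T"
  shows "abs_op T = T"
  unfolding abs_op_def
proof (rule the_equality)
  have "adj_op T = T" using assms by (simp add: adj_op_selfadjoint positive_op_def)
  then show "positive_op T \<and> T o\<^sub>L T = adj_op T o\<^sub>L T" using assms by simp
  fix P assume P: "positive_op P \<and> P o\<^sub>L P = adj_op T o\<^sub>L T"
  then have "blinfun_apply (P o\<^sub>L P) x = blinfun_apply (T o\<^sub>L T) x" for x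
    using \<open>adj_op T = T\<close> by simp
  then have "P (P x) = T (T x)" for x
    by simp
  then show "P = T"
    using P assms by (intro positive_sqrt_unique positive_op_inner) auto
qed

section \<open>The spectral theorem for positive trace class operators\<close>

text \<open>The compact set is a Minkowski sum of discs, each the continuous image of a disc of
  coefficients. It serves as the target of a finite rank approximation of a compact
  operator.\<close>

lemma compact_finite_combinations:
  assumes "finite F"
  shows "\<exists>K. compact K \<and> (\<forall>c. (\<forall>e\<in>F. cmod (c e)
    \<le> M) \<longrightarrow> (\<Sum>e\<in>F. c e *\<^sub>C (e::'a::complex_hilbert)) \<in> K)"
  using assms
proof (induction F)
  case empty
  show ?case by (rule exI[of _ "{0}"]) simp
next
  case (insert f F)
  then obtain K where K: "compact K"
    "\<And>c. (\<forall>e\<in>F. cmod (c e) \<le> M) \<Longrightarrow> (\<Sum>e\<in>F. c e *\<^sub>C e) \<in> K" by blast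
  have "bounded_linear (\<lambda>z. z *\<^sub>C f)"
    by (rule bounded_linear_intro[where K = "norm f"])
      (simp_all add: scaleC_add_left norm_scaleC scaleR_conv_of_real flip: scaleC_of_real
        scaleC_scaleC)
  then have "continuous_on (cball 0 M) (\<lambda>z. z *\<^sub>C f)"
    by (rule linear_continuous_on)
  then have "compact ((\<lambda>z. z *\<^sub>C f) ` cball 0 M)"
    by (rule compact_continuous_image) simp
  then have "compact {x + y | x y. x \<in> (\<lambda>z. z *\<^sub>C f) ` cball 0 M \<and> y \<in> K}"
    using K(1) by (rule compact_sums)
  moreover have "(\<Sum>e\<in>insert f F. c e *\<^sub>C e) \<in> {x + y | x y. x \<in> (\<lambda>z. z *\<^sub>C f) ` cball 0 M \<and> y \<in> K}"
    if "\<forall>e\<in>insert f F. cmod (c e) \<le> M" for c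
    unfolding mem_Collect_eq sum.insert[OF insert.hyps]
  proof (intro exI conjI)
    show "c f *\<^sub>C f \<in> (\<lambda>z. z *\<^sub>C f) ` cball 0 M" using that by auto
    show "(\<Sum>e\<in>F. c e *\<^sub>C e) \<in> K" using that by (intro K(2)) auto
  qed simp
  ultimately show ?case by blast
qed

text \<open>Evaluate the form <y, T y> \<ge> 0 at y = x - t T x with t = 1 / |T|: the term t^2 <T x,
  T (T x)> is at most t |T x|^2 and absorbs half of the cross term 2 t |T x|^2. For a basis, this
  turns summability of <e, T e> into summability of |T e|^2.\<close>

lemma positive_norm_apply_le:
  fixes T :: "'a::real_inner \<Rightarrow>\<^sub>L 'a"
  assumes sym: "\<And>x y. inner (T x) y = inner x (T y)" and pos: "\<And>x. 0 \<le> inner x (T x)"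
  shows "(norm (T x))\<^sup>2 \<le> norm T * inner x (T x)"
proof (cases "T = 0")
  case False
  define M where "M = norm T"
  have M: "M > 0" using False by (simp add: M_def)
  define t where "t = inverse M"
  have "inner (T x) (T (T x)) \<le> norm (T x) * (M * norm (T x))"
    using norm_cauchy_schwarz[of "T x" "T (T x)"] norm_blinfun[of T "T x"] unfolding M_def
    by (meson mult_left_mono norm_ge_zero order_trans)
  then have le: "t\<^sup>2 * inner (T x) (T (T x)) \<le> t * (norm (T x))\<^sup>2"
    using M by (simp add: t_def field_simps power2_eq_square)
  have "0 \<le> inner (x - t *\<^sub>R T x) (T (x - t *\<^sub>R T x))" by (rule pos)
  also have "\<dots> = inner x (T x) - 2 * t * (norm (T x))\<^sup>2 + t\<^sup>2 * inner (T x) (T (T x))"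
    using sym[of x "T x"] power2_norm_eq_inner[of "T x"]
    by (simp add: blinfun.diff_right blinfun.scaleR_right inner_diff_left inner_diff_right
        power2_eq_square algebra_simps)
  finally have "t * (norm (T x))\<^sup>2 \<le> inner x (T x)" using le by linarith
  then show ?thesis using M by (simp add: t_def M_def[symmetric] field_simps)
qed simp

lemma positive_trace_class_summable:
  assumes "positive_op T" "trace_class T"
  obtains E where "is_onb E" "(\<lambda>e. inner e (T e)) summable_on E"
proof -
  obtain E where "is_onb E" "(\<lambda>e. cinner e (T e)) summable_on E"
    using assms(2) unfolding trace_class_def abs_op_positive[OF assms(1)] by blast
  moreover have "(\<lambda>e. inner e (T e)) summable_on E"
    using summable_on_Re[OF calculation(2)] by (simp add: Re_cinner)
  ultimately show thesis using that by blast
qed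

text \<open>\<open>T\<close> is Hilbert-Schmidt, so the sum of |T e|^2 outside a finite set
  \<open>F\<close> of basis vectors is small. This bounds, uniformly on the unit ball, the distance
  of \<open>T x\<close> to its projection onto the span of \<open>F\<close>, and these projections
  stay in a compact set.\<close>

lemma positive_trace_class_compact:
  assumes T: "positive_op T" "trace_class T"
  shows "compact (closure (T ` cball 0 1))"
  unfolding compact_eq_totally_bounded
proof (intro conjI allI impI)
  show "complete (closure (T ` cball 0 1))" by (simp add: complete_eq_closed)
  fix \<epsilon> :: real assume "\<epsilon> > 0"
  \<comment> \<open>One \<open>\<delta>\<close> is spent on the projection and one on the finite
    net. The resulting closed balls of radius 2 \<delta> = \<epsilon> / 2 also cover the closure and
    fit into open balls of radius \<epsilon>.\<close>
  define \<delta> where "\<delta> = \<epsilon> / 4"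
  have \<delta>: "\<delta> > 0" using \<open>\<epsilon> > 0\<close> by (simp add: \<delta>_def)
  obtain E where E: "is_onb E" and sm: "(\<lambda>e. inner e (T e)) summable_on E"
    using positive_trace_class_summable[OF T] by blast
  have orth: "orthonormal E" by (rule is_onb_imp_orthonormal[OF E])
  have "(\<lambda>e. norm T * inner e (T e)) summable_on E"
    by (rule summable_on_cmult_right[OF sm])
  then have sm2: "(\<lambda>e. (norm (T e))\<^sup>2) summable_on E"
    by (rule summable_on_comparison_test)
      (use positive_norm_apply_le[OF positive_op_inner[OF T(1)]] in auto)
  obtain F where F: "finite F" "F \<subseteq> E"
    "dist (\<Sum>e\<in>F. (norm (T e))\<^sup>2) (infsum (\<lambda>e. (norm (T e))\<^sup>2) E) \<le> \<delta>\<^sup>2"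
    using infsum_finite_approximation[OF sm2, of "\<delta>\<^sup>2"] \<delta> by auto
  define p where "p y = (\<Sum>e\<in>F. cinner e y *\<^sub>C e)" for y :: 'a
  obtain K where K: "compact K"
    "\<And>c. (\<forall>e\<in>F. cmod (c e) \<le> norm T) \<Longrightarrow> (\<Sum>e\<in>F. c e *\<^sub>C e) \<in> K"
    using compact_finite_combinations[OF F(1), of "norm T"] by blast
  have approx: "p (T x) \<in> K \<and> dist (p (T x)) (T x) \<le> \<delta>" if x: "x \<in> cball 0 1" for x
  proof
    have Tx: "norm (T x) \<le> norm T"
      using norm_blinfun[of T x] x mult_left_mono[of "norm x" 1 "norm T"] by simp
    have "cmod (cinner e (T x)) \<le> norm T" if "e \<in> F" for e
    proof -
      have "norm e = 1" using that F(2) orth by (auto simp: orthonormal_def)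
      then show ?thesis using norm_cinner_le[of e "T x"] Tx by simp
    qed
    then show "p (T x) \<in> K" unfolding p_def by (intro K(2)) blast
    \<comment> \<open>Each \<open>h e\<close> is nonnegative because |<e, T x>| = |<T e, x>| \<le>
      |T e|. Bounding the part of its sum over \<open>F\<close> by the whole sum compares the tail
      of the Parseval series of \<open>T x\<close> with the tail of the sum of |T e|^2.\<close>
    define h where "h e = (norm (T e))\<^sup>2 - (cmod (cinner e (T x)))\<^sup>2" for e
    have h: "h e \<ge> 0" for e
    proof -
      have "cinner e (T x) = cinner (T e) x"
        using T(1) by (simp add: positive_op_def selfadjoint_op_def)
      then have "cmod (cinner e (T x)) \<le> norm (T e)"
        using norm_cinner_le[of "T e" x] x mult_left_mono[of "norm x" 1 "norm (T e)"] by simp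
      then show ?thesis by (simp add: h_def power_mono)
    qed
    have "((\<lambda>e. (norm (T e))\<^sup>2 + - (cmod (cinner e (T x)))\<^sup>2) has_sum
        (infsum (\<lambda>e. (norm (T e))\<^sup>2) E + - (norm (T x))\<^sup>2)) E"
      by (intro has_sum_add has_sum_infsum sm2 has_sum_uminusI Parseval_norm E)
    then have "(h has_sum (infsum (\<lambda>e. (norm (T e))\<^sup>2) E - (norm (T x))\<^sup>2)) E"
      by (simp add: h_def[abs_def])
    then have "sum h F \<le> infsum (\<lambda>e. (norm (T e))\<^sup>2) E - (norm (T x))\<^sup>2"
      by (rule finite_sum_le_has_sum) (use F h in auto)
    then have tail: "(norm (T x))\<^sup>2 - (\<Sum>e\<in>F. (cmod (cinner e (T x)))\<^sup>2) \<le> \<delta>\<^sup>2"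
      using F(3) by (simp add: h_def sum_subtractf dist_real_def)
    have "(norm (T x - p (T x)))\<^sup>2 = (norm (T x))\<^sup>2 - (\<Sum>e\<in>F. (cmod (cinner e (T x)))\<^sup>2)"
      unfolding p_def by (rule norm_diff_projection[OF orth F(1,2)])
    with tail have "(norm (T x - p (T x)))\<^sup>2 \<le> \<delta>\<^sup>2" by simp
    then show "dist (p (T x)) (T x) \<le> \<delta>"
      using \<delta> by (simp add: dist_norm norm_minus_commute power2_le_iff_abs_le)
  qed
  obtain k where k: "finite k" "K \<subseteq> (\<Union>y\<in>k. ball y \<delta>)"
    using K(1) \<delta> unfolding compact_eq_totally_bounded by blast
  have "T ` cball 0 1 \<subseteq> (\<Union>y\<in>k. cball y (2 * \<delta>))"
  proof
    fix z assume "z \<in> T ` cball 0 1"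
    then obtain x where x: "x \<in> cball 0 1" "z = T x" by blast
    obtain y where "y \<in> k" "dist y (p (T x)) < \<delta>"
      using approx[OF x(1)] k(2) by (auto simp: subset_iff)
    moreover have "dist (p (T x)) z \<le> \<delta>" using approx[OF x(1)] x(2) by simp
    ultimately have "y \<in> k" "dist y z \<le> 2 * \<delta>"
      using dist_triangle[of y z "p (T x)"] by auto
    then show "z \<in> (\<Union>y\<in>k. cball y (2 * \<delta>))" by auto
  qed
  moreover have "closed (\<Union>y\<in>k. cball y (2 * \<delta>))" using k(1) by auto
  ultimately have "closure (T ` cball 0 1) \<subseteq> (\<Union>y\<in>k. cball y (2 * \<delta>))"
    by (rule closure_minimal)
  also have "\<dots> \<subseteq> (\<Union>y\<in>k. ball y \<epsilon>)"
    using \<delta> by (intro UN_mono) (auto simp: \<delta>_def)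
  finally show "\<exists>k. finite k \<and> closure (T ` cball 0 1) \<subseteq> (\<Union>y\<in>k. ball y \<epsilon>)"
    using k(1) by blast
qed

text \<open>Zorn's lemma gives a maximal orthonormal set \<open>M\<close> of eigenvectors. Its
  orthogonal complement \<open>N\<close> is closed, invariant by symmetry of \<open>T\<close>, and
  free of unit eigenvectors by maximality, so compactness forces \<open>T\<close> to vanish on
  \<open>N\<close>. A nonzero vector of \<open>N\<close> would then be an eigenvector for 0, so
  \<open>N\<close> is trivial and \<open>M\<close> is a basis.\<close>

theorem spectral_theorem_positive_trace_class:
  fixes T :: "'a::complex_hilbert \<Rightarrow>\<^sub>L 'a"
  assumes T: "positive_op T" "trace_class T"
  obtains E where "is_onb E" "\<And>e. e \<in> E \<Longrightarrow> T e = inner e (T e) *\<^sub>R e"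
proof -
  define \<A> where "\<A> = {E. orthonormal E \<and> (\<forall>e\<in>E. \<exists>a. T e = a *\<^sub>R e)}"
  have "\<exists>M\<in>\<A>. \<forall>X\<in>\<A>. M \<subseteq> X \<longrightarrow> X = M"
  proof (rule subset_Zorn')
    fix C assume C: "subset.chain \<A> C"
    have pair: "\<exists>X\<in>C. e \<in> X \<and> f \<in> X" if ef: "e \<in> \<Union>C" "f \<in> \<Union>C" for e f
    proof -
      obtain X Y where "X \<in> C" "Y \<in> C" "e \<in> X" "f \<in> Y" using ef by blast
      moreover have "X \<subseteq> Y \<or> Y \<subseteq> X"
        using C calculation by (simp add: subset_chain_def)
      ultimately show ?thesis by blast
    qed
    have sub: "X \<in> \<A>" if "X \<in> C" for X
      using C that by (auto simp: subset_chain_def)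
    show "\<Union>C \<in> \<A>"
      unfolding \<A>_def orthonormal_def
    proof (intro CollectI conjI ballI impI)
      fix e f assume "e \<in> \<Union>C" "f \<in> \<Union>C" "e \<noteq> f"
      then obtain X where "X \<in> C" "e \<in> X" "f \<in> X" using pair by blast
      then show "cinner e f = 0"
        using sub[of X] \<open>e \<noteq> f\<close> by (auto simp: \<A>_def orthonormal_def)
    qed (use sub in \<open>auto simp: \<A>_def orthonormal_def\<close>)
  qed
  then obtain M where "M \<in> \<A>" and max: "\<forall>X\<in>\<A>. M \<subseteq> X \<longrightarrow> X = M"
    by (rule bexE)
  then have M: "orthonormal M" "\<forall>e\<in>M. \<exists>a. T e = a *\<^sub>R e"
    by (simp_all add: \<A>_def)
  define N where "N = {x. \<forall>e\<in>M. cinner e x = 0}"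
  have no_eigenvector: False if "v \<in> N" "norm v = 1" "T v = k *\<^sub>R v" for v k
  proof -
    have "cinner v e = 0" if "e \<in> M" for e
      using \<open>v \<in> N\<close> that cinner_commute[of v e] by (simp add: N_def)
    then have "insert v M \<in> \<A>"
      using that M unfolding \<A>_def orthonormal_def N_def by auto
    then have "v \<in> M" using max by blast
    then show False using that(1,2) by (auto simp: N_def cinner_self)
  qed
  have "subspace N"
    by (rule subspaceI) (simp_all add: N_def cinner_add_right cinner_scaleR_right)
  moreover have "closed N"
  proof -
    have "continuous_on UNIV (cinner e)" for e :: 'a
      using bounded_linear_cinner_right by (rule linear_continuous_on)
    then have "closed (\<Inter>e\<in>M. {x. cinner e x = 0})"
      by (intro closed_INT ballI closed_Collect_eq continuous_on_const)
    moreover have "(\<Inter>e\<in>M. {x. cinner e x = 0}) = N" by (auto simp: N_def)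
    ultimately show ?thesis by simp
  qed
  moreover have inv: "T x \<in> N" if "x \<in> N" for x
  proof -
    have "cinner e (T x) = 0" if "e \<in> M" for e
    proof -
      obtain a where "T e = a *\<^sub>R e" using M(2) \<open>e \<in> M\<close> by blast
      moreover have "cinner e (T x) = cinner (T e) x"
        using T(1) by (simp add: positive_op_def selfadjoint_op_def)
      ultimately show ?thesis using \<open>x \<in> N\<close> \<open>e \<in> M\<close> by (simp add: cinner_scaleR_left N_def)
    qed
    then show ?thesis by (simp add: N_def)
  qed
  ultimately have T0: "T x = 0" if "x \<in> N" for x
    using compact_positive_eigenvector[OF positive_op_inner[OF T(1)]
        positive_trace_class_compact[OF T], of N x] no_eigenvector that by metis
  have "x = 0" if "x \<in> N" for x
  proof (rule ccontr)
    assume "x \<noteq> 0"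
    show False
    proof (rule no_eigenvector)
      show "inverse (norm x) *\<^sub>R x \<in> N"
        using that \<open>subspace N\<close> by (simp add: subspace_scale)
      show "norm (inverse (norm x) *\<^sub>R x) = 1" using \<open>x \<noteq> 0\<close> by simp
      show "T (inverse (norm x) *\<^sub>R x) = 0 *\<^sub>R (inverse (norm x) *\<^sub>R x)"
        by (simp add: blinfun.scaleR_right T0[OF that])
    qed
  qed
  then have onb: "is_onb M"
    using M(1) by (simp add: is_onb_def orthonormal_def N_def)
  have eig: "T e = inner e (T e) *\<^sub>R e" if "e \<in> M" for e
  proof -
    obtain a where "T e = a *\<^sub>R e" using M(2) \<open>e \<in> M\<close> by auto
    then show ?thesis using M(1) that by (simp add: orthonormal_def norm_eq_1)
  qed
  show thesis by (rule that[OF onb eig])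
qed

section \<open>Diagonal operators and functional calculus\<close>

text \<open>Phrased through the coefficients of \<open>X x\<close> rather than the values
  \<open>X e\<close>, so that polynomials, differences and inverses are computed coefficientwise and
  operators are compared by \<open>onb_eqI\<close>.\<close>

definition diagonal_op :: "'a::complex_hilbert set \<Rightarrow> ('a \<Rightarrow> real) \<Rightarrow> ('a \<Rightarrow>\<^sub>L 'a) \<Rightarrow> bool" where
  "diagonal_op E \<alpha> X \<longleftrightarrow> (\<forall>e\<in>E. \<forall>x. cinner e (X x) = of_real (\<alpha> e) * cinner e x)"

lemma diagonal_opD: "diagonal_op E \<alpha> X \<Longrightarrow> e \<in> E \<Longrightarrow> cinner e (X x) = of_real (\<alpha> e) * cinner e x"
  by (simp add: diagonal_op_def)

lemma diagonal_op_eigenbasis: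
  assumes "selfadjoint_op T" "\<And>e. e \<in> E \<Longrightarrow> T e = \<alpha> e *\<^sub>R e"
  shows "diagonal_op E \<alpha> T"
  unfolding diagonal_op_def
proof (intro ballI allI)
  fix e x assume "e \<in> E"
  have "cinner e (T x) = cinner (T e) x" using assms(1) by (simp add: selfadjoint_op_def)
  then show "cinner e (T x) = of_real (\<alpha> e) * cinner e x"
    by (simp add: assms(2)[OF \<open>e \<in> E\<close>] cinner_scaleR_left)
qed

lemma diagonal_op_apply:
  assumes "is_onb E" "diagonal_op E \<alpha> X" "e \<in> E"
  shows "X e = \<alpha> e *\<^sub>R e"
proof (rule onb_eqI[OF assms(1)])
  fix f assume "f \<in> E"
  then show "cinner f (X e) = cinner f (\<alpha> e *\<^sub>R e)"
    using assms(3) by (simp add: diagonal_opD[OF assms(2)] cinner_scaleR_right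
        cinner_orthonormal[OF is_onb_imp_orthonormal[OF assms(1)]])
qed

lemma diagonal_op_complex_linear:
  assumes "is_onb E" "diagonal_op E \<alpha> X"
  shows "complex_linear_op X"
  unfolding complex_linear_op_def
  by (intro allI onb_eqI[OF assms(1)]) (simp add: diagonal_opD[OF assms(2)] cinner_scaleC_right)

lemma diagonal_op_symmetric:
  assumes "is_onb E" "diagonal_op E \<alpha> X"
  shows "cinner (X x) y = cinner x (X y)"
proof -
  have "cinner (X x) e * cinner e y = cinner x e * cinner e (X y)" if "e \<in> E" for e
    using cinner_commute[of "X x" e] cinner_commute[of x e]
    by (simp add: diagonal_opD[OF assms(2) that])
  then have "((\<lambda>e. cinner x e * cinner e (X y)) has_sum cinner (X x) y) E"
    using Parseval_cinner[OF assms(1), of "X x" y] by (simp cong: has_sum_cong)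
  then show ?thesis
    using Parseval_cinner[OF assms(1), of x "X y"] has_sum_unique by blast
qed

lemma diagonal_op_norm_le:
  assumes "is_onb E" "diagonal_op E \<alpha> X" "\<And>e. e \<in> E \<Longrightarrow> \<bar>\<alpha> e\<bar> \<le> C" "0 \<le> C"
  shows "norm X \<le> C"
proof (rule norm_blinfun_bound[OF assms(4)])
  fix x
  have "((\<lambda>e. C\<^sup>2 * (cmod (cinner e x))\<^sup>2) has_sum C\<^sup>2 * (norm x)\<^sup>2) E"
    by (intro has_sum_cmult_right Parseval_norm assms(1))
  moreover have "(cmod (cinner e (X x)))\<^sup>2 \<le> C\<^sup>2 * (cmod (cinner e x))\<^sup>2" if "e \<in> E" for e
    using power_mono[OF assms(3)[OF that], of 2]
    by (simp add: diagonal_opD[OF assms(2) that] norm_mult power_mult_distrib mult_right_mono)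
  ultimately have "(norm (X x))\<^sup>2 \<le> C\<^sup>2 * (norm x)\<^sup>2"
    using has_sum_mono[OF Parseval_norm[OF assms(1), of "X x"]] by blast
  then have "(norm (X x))\<^sup>2 \<le> (C * norm x)\<^sup>2" by (simp add: power_mult_distrib)
  then show "norm (X x) \<le> C * norm x"
    by (rule power2_le_imp_le) (simp add: assms(4))
qed

text \<open>Bounded factors keep coefficients square summable, so Riesz-Fischer applies. Both the
  resolvent and the limit in the functional calculus are obtained from here.\<close>

lemma diagonal_op_exists:
  assumes E: "is_onb E" and C: "\<And>e. e \<in> E \<Longrightarrow> \<bar>\<alpha> e\<bar> \<le> C"
  obtains X where "diagonal_op E \<alpha> X"
proof -
  have orth: "orthonormal E" by (rule is_onb_imp_orthonormal[OF E])
  define g where "g x = (\<Sum>\<^sub>\<infinity>e\<in>E. (of_real (\<alpha> e) * cinner e x) *\<^sub>C e)" for x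
  have le: "(cmod (of_real (\<alpha> e) * cinner e x))\<^sup>2 \<le> C\<^sup>2 * (cmod (cinner e x))\<^sup>2" if "e \<in> E" for e x
    using power_mono[OF C[OF that], of 2]
    by (simp add: norm_mult power_mult_distrib mult_right_mono)
  have "(\<lambda>e. (cmod (of_real (\<alpha> e) * cinner e x))\<^sup>2) summable_on E" for x
    by (rule summable_on_comparison_test[OF summable_on_cmult_right[OF Bessel_summable[OF orth]]])
      (use le in auto)
  then have "((\<lambda>e. (of_real (\<alpha> e) * cinner e x) *\<^sub>C e) has_sum g x) E" for x
    unfolding g_def by (intro has_sum_infsum orthonormal_series_summable orth)
  then have g: "cinner e (g x) = of_real (\<alpha> e) * cinner e x" if "e \<in> E" for e x
    by (rule cinner_orthonormal_series[OF orth _ that])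
  have "bounded_linear g"
  proof (rule bounded_linear_intro)
    show "g (x + y) = g x + g y" for x y
      by (rule onb_eqI[OF E]) (simp add: g cinner_add_right distrib_left)
    show "g (r *\<^sub>R x) = r *\<^sub>R g x" for r x
      by (rule onb_eqI[OF E]) (simp add: g cinner_scaleR_right)
    show "norm (g x) \<le> norm x * \<bar>C\<bar>" for x
    proof (rule power2_le_imp_le)
      have "(norm (g x))\<^sup>2 \<le> C\<^sup>2 * (norm x)\<^sup>2"
        by (rule has_sum_mono[OF Parseval_norm[OF E] has_sum_cmult_right[OF Parseval_norm[OF E]]])
          (use le g in auto)
      then show "(norm (g x))\<^sup>2 \<le> (norm x * \<bar>C\<bar>)\<^sup>2" by (simp add: power_mult_distrib mult.commute)
    qed simp
  qed
  then have "diagonal_op E \<alpha> (Blinfun g)"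
    by (simp add: diagonal_op_def bounded_linear_Blinfun_apply g)
  then show thesis by (rule that)
qed

lemma diagonal_op_id: "diagonal_op E (\<lambda>_. 1) id_blinfun"
  by (simp add: diagonal_op_def)

lemma diagonal_op_diff:
  "diagonal_op E \<alpha> X \<Longrightarrow> diagonal_op E \<beta> Y \<Longrightarrow> diagonal_op E (\<lambda>e. \<alpha> e - \<beta> e) (X - Y)"
  by (simp add: diagonal_op_def blinfun.diff_left cinner_diff_right left_diff_distrib)

lemma diagonal_op_power:
  "diagonal_op E \<alpha> T \<Longrightarrow> diagonal_op E (\<lambda>e. \<alpha> e ^ i) (((o\<^sub>L) T ^^ i) id_blinfun)"
  by (induction i) (simp_all add: diagonal_op_def blinfun_compose.rep_eq)

lemma diagonal_op_poly:
  assumes "diagonal_op E \<alpha> T"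
  shows "diagonal_op E (\<lambda>e. poly p (\<alpha> e)) (poly_op p T)"
  unfolding diagonal_op_def poly_op_def poly_altdef
  using diagonal_opD[OF diagonal_op_power[OF assms]]
  by (simp add: blinfun.sum_left blinfun.scaleR_left cinner_sum_right cinner_scaleR_right
      sum_distrib_right mult.assoc)

section \<open>Spectrum and continuous functional calculus of a diagonal operator\<close>

lemma eigenvalue_in_spectrum:
  fixes T :: "'a::complex_hilbert \<Rightarrow>\<^sub>L 'a"
  assumes "T e = a *\<^sub>R e" "e \<noteq> 0"
  shows "complex_of_real a \<in> spectrum_op T"
  unfolding spectrum_op_def
proof (intro CollectI notI, elim exE conjE)
  fix R :: "'a \<Rightarrow>\<^sub>L 'a" assume "\<forall>x. R (T x - complex_of_real a *\<^sub>C x) = x"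
  then have "R (T e - complex_of_real a *\<^sub>C e) = e" by blast
  then show False using assms by (simp add: scaleC_of_real blinfun.zero_right)
qed

text \<open>If |t| > M, the entries 1 / (\<alpha> e - t) are bounded by 1 / (|t| - M), and the
  diagonal operator with these entries inverts T - t. Confining the real spectrum to an interval
  makes Weierstrass approximation on that interval usable in \<open>fun_calc\<close>.\<close>

lemma diagonal_op_spectrum_bounded:
  assumes E: "is_onb E" and T: "diagonal_op E \<alpha> T" and M: "\<And>e. e \<in> E \<Longrightarrow> \<bar>\<alpha> e\<bar> \<le> M"
    and t: "complex_of_real t \<in> spectrum_op T"
  shows "\<bar>t\<bar> \<le> M"
proof (rule ccontr)
  assume "\<not> \<bar>t\<bar> \<le> M"
  then have gap: "0 < \<bar>t\<bar> - M" "\<And>e. e \<in> E \<Longrightarrow> \<bar>t\<bar> - M \<le> \<bar>\<alpha> e - t\<bar>"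
    using M by (auto simp: abs_if) (smt (verit) M)+
  then have ne: "\<alpha> e \<noteq> t" if "e \<in> E" for e using that by fastforce
  have "\<bar>inverse (\<alpha> e - t)\<bar> \<le> inverse (\<bar>t\<bar> - M)" if "e \<in> E" for e
    using gap(1) gap(2)[OF that] by (simp add: le_imp_inverse_le)
  then obtain R where R: "diagonal_op E (\<lambda>e. inverse (\<alpha> e - t)) R"
    by (rule diagonal_op_exists[OF E])
  have nz: "inverse (complex_of_real (\<alpha> e) - complex_of_real t)
      * (complex_of_real (\<alpha> e) - complex_of_real t) = 1" if "e \<in> E" for e
    using ne[OF that] by simp
  have "R (T x - complex_of_real t *\<^sub>C x) = x" for x
    by (rule onb_eqI[OF E])
      (simp add: diagonal_opD[OF T] diagonal_opD[OF R] cinner_diff_right cinner_scaleC_right nz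
        flip: left_diff_distrib mult.assoc)
  moreover have "T (R x) - complex_of_real t *\<^sub>C R x = x" for x
    by (rule onb_eqI[OF E])
      (simp add: diagonal_opD[OF T] diagonal_opD[OF R] cinner_diff_right cinner_scaleC_right nz
        mult.commute[of "_ - _" "inverse _"] flip: left_diff_distrib mult.assoc)
  ultimately show False
    using t diagonal_op_complex_linear[OF E R] unfolding spectrum_op_def by blast
qed

lemma Weierstrass_uniform_limit:
  fixes f :: "real \<Rightarrow> real"
  assumes "continuous_on {a..b} f"
  obtains q :: "nat \<Rightarrow> real poly" where "uniform_limit {a..b} (\<lambda>n. poly (q n)) f sequentially"
proof -
  have "\<exists>p. \<forall>x\<in>{a..b}. \<bar>f x - poly p x\<bar> < inverse (real (Suc n))" for n
  proof -
    obtain g where g: "real_polynomial_function g"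
      "\<And>x. x \<in> {a..b} \<Longrightarrow> \<bar>f x - g x\<bar> < inverse (real (Suc n))"
      by (rule Stone_Weierstrass_real_polynomial_function[OF compact_Icc assms, of "inverse (real
        (Suc n))"]) auto
    obtain c m where "g = (\<lambda>x. \<Sum>i\<le>m. c i * x ^ i)"
      using g(1) real_polynomial_function_iff_sum by blast
    then have "g x = poly (\<Sum>i\<le>m. monom (c i) i) x" for x
      by (simp add: poly_sum poly_monom)
    then show ?thesis using g(2) by (intro exI[of _ "\<Sum>i\<le>m. monom (c i) i"]) simp
  qed
  then obtain q where q: "\<And>n x. x \<in> {a..b} \<Longrightarrow> \<bar>f x - poly (q n) x\<bar> < inverse (real (Suc n))"
    by metis
  have "uniform_limit {a..b} (\<lambda>n. poly (q n)) f sequentially"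
  proof (rule uniform_limitI)
    fix \<epsilon> :: real assume "\<epsilon> > 0"
    then have "\<forall>\<^sub>F n in sequentially. inverse (real (Suc n)) < \<epsilon>"
      by (rule order_tendstoD(2)[OF LIMSEQ_inverse_real_of_nat])
    then show "\<forall>\<^sub>F n in sequentially. \<forall>x\<in>{a..b}. dist (poly (q n) x) (f x) < \<epsilon>"
    proof eventually_elim
      case (elim n)
      show ?case
      proof
        fix x assume "x \<in> {a..b}"
        then show "dist (poly (q n) x) (f x) < \<epsilon>"
          using q[of x n] elim by (simp add: dist_real_def)
      qed
    qed
  qed
  then show thesis by (rule that)
qed

text \<open>
  The eigenvalues lie in the spectrum, so uniform convergence there bounds the operator norm of
  the difference of diagonal operators.
\<close>

lemma diagonal_op_fun_calc:
  assumes E: "is_onb E" and T: "diagonal_op E \<alpha> T" and M: "\<And>e. e \<in> E \<Longrightarrow> \<bar>\<alpha> e\<bar> \<le> M"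
    and f: "continuous_on {- M..M} f"
  shows "diagonal_op E (\<lambda>e. f (\<alpha> e)) (fun_calc f T)"
proof -
  define S where "S = {t. complex_of_real t \<in> spectrum_op T}"
  have S: "S \<subseteq> {- M..M}"
    using diagonal_op_spectrum_bounded[OF E T M] by (force simp: S_def abs_le_iff)
  have in_S: "\<alpha> e \<in> S" if "e \<in> E" for e
  proof -
    have "e \<noteq> 0" using E that by (auto simp: is_onb_def)
    then show ?thesis
      unfolding S_def using eigenvalue_in_spectrum diagonal_op_apply[OF E T that] by blast
  qed
  have "bounded (f ` {- M..M})"
    by (intro compact_imp_bounded compact_continuous_image f) simp
  then obtain C where "\<And>x. x \<in> {- M..M} \<Longrightarrow> \<bar>f x\<bar> \<le> C"
    by (force simp: bounded_iff)
  then have fb: "\<bar>f (\<alpha> e)\<bar> \<le> C" if "e \<in> E" for e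
    using M[OF that] by (auto simp: abs_le_iff)
  then obtain X where X: "diagonal_op E (\<lambda>e. f (\<alpha> e)) X"
    by (rule diagonal_op_exists[OF E])
  have conv: "(\<lambda>n. poly_op (q n) T) \<longlonglongrightarrow> X"
    if q: "uniform_limit S (\<lambda>n. poly (q n)) f sequentially" for q
  proof (rule tendstoI)
    fix \<epsilon> :: real assume "\<epsilon> > 0"
    then have "\<forall>\<^sub>F n in sequentially. \<forall>t\<in>S. dist (poly (q n) t) (f t) < \<epsilon> / 2"
      by (intro uniform_limitD[OF q]) simp
    then show "\<forall>\<^sub>F n in sequentially. dist (poly_op (q n) T) X < \<epsilon>"
    proof eventually_elim
      case (elim n)
      have "norm (poly_op (q n) T - X) \<le> \<epsilon> / 2"
      proof (rule diagonal_op_norm_le[OF E diagonal_op_diff[OF diagonal_op_poly[OF T] X]])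
        fix e assume "e \<in> E"
        then show "\<bar>poly (q n) (\<alpha> e) - f (\<alpha> e)\<bar> \<le> \<epsilon> / 2"
          using elim in_S by (force simp: dist_real_def)
      qed (use \<open>\<epsilon> > 0\<close> in simp)
      then show ?case using \<open>\<epsilon> > 0\<close> by (simp add: dist_norm)
    qed
  qed
  \<comment> \<open>The description quantifies over all approximating sequences, so it singles out a
    limit only once some such sequence exists.\<close>
  obtain q where "uniform_limit {- M..M} (\<lambda>n. poly (q n)) f sequentially"
    using Weierstrass_uniform_limit[OF f] by blast
  then have q: "uniform_limit S (\<lambda>n. poly (q n)) f sequentially"
    using S by (rule uniform_limit_on_subset)
  have "fun_calc f T = X"
    unfolding fun_calc_def S_def[symmetric]
  proof (rule the_equality)
    show "\<forall>q. uniform_limit S (\<lambda>n. poly (q n)) f sequentially \<longrightarrow> (\<lambda>n. poly_op (q n) T) \<longlonglongrightarrow> X"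
      using conv by blast
    fix Y assume "\<forall>q. uniform_limit S (\<lambda>n. poly (q n)) f sequentially \<longrightarrow> (\<lambda>n. poly_op (q n) T) \<longlonglongrightarrow> Y"
    then show "Y = X" using conv[OF q] q LIMSEQ_unique by blast
  qed
  then show ?thesis using X by simp
qed

text \<open>In the library \<open>0 powr 0 = 0\<close>, whereas \<open>X\<^sup>0 = I\<close> also on the kernel of \<open>X\<close>.\<close>

definition pow0 :: "real \<Rightarrow> real \<Rightarrow> real" where
  "pow0 x s = (if s = 0 then 1 else x powr s)"

lemma pow0_nonneg [simp]: "0 \<le> pow0 x s"
  by (simp add: pow0_def)

lemma diagonal_op_op_power:
  assumes E: "is_onb E" and T: "diagonal_op E \<alpha> T" and M: "\<And>e. e \<in> E \<Longrightarrow> \<bar>\<alpha> e\<bar> \<le> M"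
    and s: "0 \<le> s"
  shows "diagonal_op E (\<lambda>e. pow0 (\<alpha> e) s) (op_power T s)"
proof (cases "s = 0")
  case True
  then show ?thesis using diagonal_op_id by (simp add: op_power_def pow0_def)
next
  case False
  \<comment> \<open>The interval reaches below 0, where \<open>powr\<close> is even in its base by
    convention. Written with the absolute value, the base is nonnegative and s > 0 yields continuity
    at 0 as well.\<close>
  have "continuous_on {- M..M} (\<lambda>t. \<bar>t\<bar> powr s)"
    using False s by (intro continuous_on_powr' continuous_intros) auto
  moreover have "\<bar>t\<bar> powr s = t powr s" for t :: real
    by (simp add: abs_if uminus_powr_eq)
  ultimately have "continuous_on {- M..M} (\<lambda>t. t powr s)" by simp
  then show ?thesis
    using diagonal_op_fun_calc[OF E T M] False by (simp add: op_power_def pow0_def)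
qed

section \<open>Traces of products of diagonal operators\<close>

lemma cmod_cinner_commute: "cmod (cinner x y) = cmod (cinner y x)"
  using cinner_commute[of x y] by simp

lemma onb_product_abs_summable:
  assumes "is_onb G"
  shows "(\<lambda>g. cmod (cinner x g * cinner g y)) summable_on G" (is ?A)
    and "(\<Sum>\<^sub>\<infinity>g\<in>G. cmod (cinner x g * cinner g y)) \<le> (norm x)\<^sup>2 + (norm y)\<^sup>2" (is ?B)
proof -
  have hs: "((\<lambda>g. (cmod (cinner g x))\<^sup>2 + (cmod (cinner g y))\<^sup>2) has_sum (norm x)\<^sup>2 + (norm y)\<^sup>2) G"
    by (intro has_sum_add Parseval_norm assms)
  have le: "cmod (cinner x g * cinner g y) \<le> (cmod (cinner g x))\<^sup>2 + (cmod (cinner g y))\<^sup>2" for g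
  proof -
    have "2 * (cmod (cinner g x) * cmod (cinner g y))
      \<le> (cmod (cinner g x))\<^sup>2 + (cmod (cinner g y))\<^sup>2"
      using sum_squares_bound[of "cmod (cinner g x)" "cmod (cinner g y)"] by simp
    moreover have "0 \<le> cmod (cinner g x) * cmod (cinner g y)" by simp
    ultimately show ?thesis unfolding norm_mult cmod_cinner_commute[of x g] by linarith
  qed
  show ?A
    by (rule summable_on_comparison_test[OF has_sum_imp_summable[OF hs]]) (use le in auto)
  then show ?B
    using has_sum_mono[OF has_sum_infsum hs] le by blast
qed

text \<open>The trace uses an arbitrary basis \<open>G\<close>, unrelated to \<open>E\<close>. The
  double series of \<alpha> e <Y e, g> <g, e> is absolutely summable, as its sum of moduli over
  \<open>g\<close> is at most \<alpha> e (|Y|^2 + 1). Summing over \<open>g\<close> before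
  \<open>e\<close> gives the expansion in \<open>E\<close>; the other order gives the trace in
  \<open>G\<close>. Both inner sums are Parseval identities.\<close>

lemma trace_op_compose_diagonal:
  fixes X Y :: "'a::complex_hilbert \<Rightarrow>\<^sub>L 'a"
  assumes E: "is_onb E" and X: "diagonal_op E \<alpha> X"
    and \<alpha>: "\<alpha> summable_on E" "\<And>e. e \<in> E \<Longrightarrow> 0 \<le> \<alpha> e"
    and Y: "\<And>x y. cinner (Y x) y = cinner x (Y y)"
  shows "((\<lambda>e. of_real (\<alpha> e) * cinner e (Y e)) has_sum trace_op (X o\<^sub>L Y)) E"
proof -
  define G :: "'a set" where "G = (SOME E. is_onb E)"
  have G: "is_onb G" unfolding G_def using E by (rule someI)
  define h where "h = (\<lambda>(e, g). of_real (\<alpha> e) * (cinner (Y e) g * cinner g e))"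
  define D where "D = (norm Y)\<^sup>2 + 1"
  have inner_sum: "(\<lambda>g. cmod (h (e, g))) summable_on G"
    "(\<Sum>\<^sub>\<infinity>g\<in>G. cmod (h (e, g))) \<le> \<alpha> e * D" if "e \<in> E" for e
  proof -
    have e: "norm e = 1" using E that by (simp add: is_onb_def)
    have h: "cmod (h (e, g)) = \<alpha> e * cmod (cinner (Y e) g * cinner g e)" for g
      using \<alpha>(2)[OF that] by (simp add: h_def norm_mult)
    show "(\<lambda>g. cmod (h (e, g))) summable_on G"
      unfolding h by (intro summable_on_cmult_right onb_product_abs_summable G)
    have "(norm (Y e))\<^sup>2 \<le> (norm Y)\<^sup>2"
      using norm_blinfun[of Y e] e by (intro power_mono) auto
    moreover have "(\<Sum>\<^sub>\<infinity>g\<in>G. cmod (cinner (Y e) g * cinner g e)) \<le> (norm (Y e))\<^sup>2 + 1"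
      using onb_product_abs_summable(2)[OF G, of "Y e" e] e by simp
    ultimately have "(\<Sum>\<^sub>\<infinity>g\<in>G. cmod (cinner (Y e) g * cinner g e)) \<le> D"
      unfolding D_def by linarith
    then show "(\<Sum>\<^sub>\<infinity>g\<in>G. cmod (h (e, g))) \<le> \<alpha> e * D"
      unfolding h infsum_cmult_right' using \<alpha>(2)[OF that] by (rule mult_left_mono)
  qed
  have "(\<lambda>e. (\<Sum>\<^sub>\<infinity>g\<in>G. cmod (h (e, g)))) summable_on E"
    by (rule summable_on_comparison_test[OF summable_on_cmult_left[OF \<alpha>(1)]])
      (use inner_sum(2) in \<open>auto intro: infsum_nonneg\<close>)
  then have "(\<lambda>x. norm (h x)) summable_on E \<times> G"
    unfolding Infinite_Sum.abs_summable_on_Sigma_iff using inner_sum(1) by (simp add: infsum_nonneg)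
  then have "h summable_on E \<times> G" by (rule Infinite_Sum.abs_summable_summable)
  then obtain S where S: "(h has_sum S) (E \<times> G)" by (auto simp: summable_on_def)
  have "((\<lambda>e. of_real (\<alpha> e) * cinner e (Y e)) has_sum S) E"
  proof (rule has_sum_SigmaD[OF S])
    fix e assume "e \<in> E"
    show "((\<lambda>g. h (e, g)) has_sum of_real (\<alpha> e) * cinner e (Y e)) G"
      using has_sum_cmult_right[OF Parseval_cinner[OF G, of "Y e" e]] by (simp add: h_def Y)
  qed
  moreover have "((\<lambda>g. cinner g ((X o\<^sub>L Y) g)) has_sum S) G"
  proof (rule has_sum_SigmaD[OF S[unfolded has_sum_swap[of h]]])
    fix g assume "g \<in> G"
    have "h (e, g) = cinner g e * cinner e ((X o\<^sub>L Y) g)" if "e \<in> E" for e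
      by (simp add: h_def Y diagonal_opD[OF X that] blinfun_compose.rep_eq)
    then show "((\<lambda>e. case (g, e) of (x, y) \<Rightarrow> h (y, x)) has_sum cinner g ((X o\<^sub>L Y) g)) E"
      using Parseval_cinner[OF E, of g "(X o\<^sub>L Y) g"] by (simp cong: has_sum_cong)
  qed
  then have "trace_op (X o\<^sub>L Y) = S"
    unfolding trace_op_def G_def[symmetric] by (rule infsumI)
  ultimately show ?thesis by simp
qed

text \<open>The two products are adjoint to each other, so their diagonal entries are conjugate.
  Once the trace is known to be real, the factors commute under it.\<close>

lemma trace_op_compose_commute:
  fixes X Y :: "'a::complex_hilbert \<Rightarrow>\<^sub>L 'a"
  assumes X: "\<And>x y. cinner (X x) y = cinner x (X y)" and Y: "\<And>x y. cinner (Y x) y = cinner x (Y y)"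
  shows "trace_op (Y o\<^sub>L X) = cnj (trace_op (X o\<^sub>L Y))"
proof -
  have "cinner g ((Y o\<^sub>L X) g) = cnj (cinner g ((X o\<^sub>L Y) g))" for g
    using cinner_commute[of "Y g" "X g"] by (simp add: blinfun_compose.rep_eq X Y)
  then show ?thesis unfolding trace_op_def by simp
qed

lemma diagonal_op_quadratic_form:
  assumes "is_onb F" "diagonal_op F \<beta> Y"
  shows "((\<lambda>f. \<beta> f * (cmod (cinner f x))\<^sup>2) has_sum inner x (Y x)) F"
proof -
  have "cinner x f * cinner f (Y x) = of_real (\<beta> f * (cmod (cinner f x))\<^sup>2)" if "f \<in> F" for f
    using cinner_commute[of x f]
    by (simp add: diagonal_opD[OF assms(2) that] complex_norm_square mult.assoc mult.left_commute
        del: of_real_power)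
  then have "((\<lambda>f. of_real (\<beta> f * (cmod (cinner f x))\<^sup>2)) has_sum cinner x (Y x)) F"
    using Parseval_cinner[OF assms(1), of x "Y x"] by (simp cong: has_sum_cong)
  from has_sum_Re[OF this] show ?thesis
    by (simp only: Re_cinner Re_complex_of_real)
qed

text \<open>Expand <e, Y e> in \<open>F\<close>; nonnegativity of the terms turns the iterated sum
  into a sum over pairs. Both orders of the product are recorded so that the summable factor may
  stand on either side.\<close>

lemma trace_op_diagonal_diagonal:
  assumes E: "is_onb E" and F: "is_onb F" and X: "diagonal_op E \<alpha> X" and Y: "diagonal_op F \<beta> Y"
    and \<alpha>: "\<alpha> summable_on E" "\<And>e. e \<in> E \<Longrightarrow> 0 \<le> \<alpha> e" and \<beta>: "\<And>f. f \<in> F \<Longrightarrow> 0 \<le> \<beta> f"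
  obtains t where "((\<lambda>(e, f). \<alpha> e * \<beta> f * (cmod (cinner e f))\<^sup>2) has_sum t) (E \<times> F)"
    "trace_op (X o\<^sub>L Y) = complex_of_real t" "trace_op (Y o\<^sub>L X) = complex_of_real t"
proof -
  note symX = diagonal_op_symmetric[OF E X] and symY = diagonal_op_symmetric[OF F Y]
  have "cinner e (Y e) = of_real (inner e (Y e))" for e
    using cinner_commute[of e "Y e"] symY[of e e]
    by (metis Re_cinner Reals_cnj_iff of_real_Re)
  then have hs: "((\<lambda>e. complex_of_real (\<alpha> e * inner e (Y e))) has_sum trace_op (X o\<^sub>L Y)) E"
    using trace_op_compose_diagonal[OF E X \<alpha> symY] by simp
  define t where "t = Re (trace_op (X o\<^sub>L Y))"
  have t: "((\<lambda>e. \<alpha> e * inner e (Y e)) has_sum t) E"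
    using has_sum_Re[OF hs] by (simp add: t_def)
  have trace: "trace_op (X o\<^sub>L Y) = of_real t"
    using has_sum_of_real[OF t] hs by (rule has_sum_unique[symmetric])
  have inner_sum: "((\<lambda>f. (\<lambda>(e, f). \<alpha> e * \<beta> f * (cmod (cinner e f))\<^sup>2) (e, f)) has_sum \<alpha> e * inner
    e (Y e)) F" for e
    using has_sum_cmult_right[OF diagonal_op_quadratic_form[OF F Y, of e], of "\<alpha> e"]
    by (simp add: mult.assoc cmod_cinner_commute[of e])
  have "((\<lambda>(e, f). \<alpha> e * \<beta> f * (cmod (cinner e f))\<^sup>2) has_sum t) (E \<times> F)"
  proof (rule has_sum_SigmaI[OF inner_sum t])
    show "(\<lambda>(e, f). \<alpha> e * \<beta> f * (cmod (cinner e f))\<^sup>2) summable_on E \<times> F"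
      by (rule summable_on_SigmaI[OF inner_sum has_sum_imp_summable[OF t]]) (use \<alpha> \<beta> in auto)
  qed
  moreover have "trace_op (Y o\<^sub>L X) = of_real t"
    using trace_op_compose_commute[OF symX symY] trace by simp
  ultimately show thesis using that trace by blast
qed

section \<open>Summable eigenvalue families and traces of powers\<close>

definition eigenbasis :: "'a::complex_hilbert set \<Rightarrow> ('a \<Rightarrow> real) \<Rightarrow> ('a \<Rightarrow>\<^sub>L 'a) \<Rightarrow> bool" where
  "eigenbasis E a T \<longleftrightarrow> is_onb E \<and> diagonal_op E a T \<and> a summable_on E \<and> (\<forall>e\<in>E. 0 \<le> a e \<and> a e
    \<le> norm T)"

text \<open>Trace class gives summability in some basis \<open>G\<close>, whereas the eigenvalues
  are indexed by \<open>E\<close>. Tonelli transfers it: the terms a e |<e, g>|^2 sum to <g, T g>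
  over \<open>e\<close> and to a e over \<open>g\<close>.\<close>

lemma positive_trace_class_eigenbasis:
  assumes T: "positive_op T" "trace_class T"
  obtains E a where "eigenbasis E a T"
proof -
  obtain E where E: "is_onb E" and eig: "\<And>e. e \<in> E \<Longrightarrow> T e = inner e (T e) *\<^sub>R e"
    by (rule spectral_theorem_positive_trace_class[OF T]) blast
  define a where "a e = inner e (T e)" for e
  have diag: "diagonal_op E a T"
    using T(1) eig by (intro diagonal_op_eigenbasis) (auto simp: positive_op_def a_def)
  have nonneg: "0 \<le> a e" for e
    unfolding a_def by (rule positive_op_inner(2)[OF T(1)])
  have le: "a e \<le> norm T" if "e \<in> E" for e
    using norm_cauchy_schwarz[of e "T e"] norm_blinfun[of T e] E that
      by (simp add: a_def is_onb_def)
  obtain G where G: "is_onb G" and sm: "(\<lambda>g. inner g (T g)) summable_on G"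
    using positive_trace_class_summable[OF T] by blast
  have "(\<lambda>(g, e). a e * (cmod (cinner e g))\<^sup>2) summable_on G \<times> E"
    by (rule summable_on_SigmaI[OF _ sm]) (use diagonal_op_quadratic_form[OF E diag] nonneg in auto)
  then have "(\<lambda>(e, g). a e * (cmod (cinner e g))\<^sup>2) summable_on E \<times> G"
    by (subst summable_on_swap) simp
  then have "(\<lambda>e. (\<Sum>\<^sub>\<infinity>g\<in>G. a e * (cmod (cinner e g))\<^sup>2)) summable_on E"
    by (rule summable_on_Sigma_banach)
  moreover have "(\<Sum>\<^sub>\<infinity>g\<in>G. a e * (cmod (cinner e g))\<^sup>2) = a e" if "e \<in> E" for e
    using has_sum_cmult_right[OF Parseval_norm[OF G, of e], of "a e"] E that
    by (intro infsumI) (simp add: is_onb_def cmod_cinner_commute[of e])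
  ultimately have "a summable_on E" by (simp cong: summable_on_cong)
  then show thesis using that E diag nonneg le unfolding eigenbasis_def by blast
qed

lemma eigenbasis_op_power:
  assumes "eigenbasis E a T" "0 \<le> s"
  shows "diagonal_op E (\<lambda>e. pow0 (a e) s) (op_power T s)"
  using assms by (intro diagonal_op_op_power[where M = "norm T"]) (auto simp: eigenbasis_def)

lemma eigenbasis_op_power_1:
  assumes "eigenbasis E a T"
  shows "op_power T 1 = T"
proof (rule blinfun_eqI, rule onb_eqI)
  show "is_onb E" using assms by (simp add: eigenbasis_def)
  fix x e assume "e \<in> E"
  then show "cinner e (op_power T 1 x) = cinner e (T x)"
    using diagonal_opD[OF eigenbasis_op_power[OF assms, of 1]] assms
    by (simp add: eigenbasis_def pow0_def diagonal_op_def)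
qed

text \<open>a^s = a^(s-1) a, and the first factor is bounded when s \<ge> 1. For smaller exponents,
  powers of a summable family may fail to be summable.\<close>

lemma eigenbasis_power_summable:
  assumes "eigenbasis E a T" "1 \<le> s"
  shows "(\<lambda>e. pow0 (a e) s) summable_on E"
proof (rule summable_on_comparison_test)
  show "(\<lambda>e. norm T powr (s - 1) * a e) summable_on E"
    using assms(1) by (intro summable_on_cmult_right) (simp add: eigenbasis_def)
  fix e assume "e \<in> E"
  then have a: "0 \<le> a e" "a e \<le> norm T" using assms(1) by (auto simp: eigenbasis_def)
  have "a e powr s = a e powr (s - 1) * a e"
    using powr_mult_base[OF a(1), of "s - 1"] by (simp add: mult.commute)
  also have "\<dots> \<le> norm T powr (s - 1) * a e"
    using a assms(2) by (intro mult_right_mono powr_mono2) auto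
  finally show "pow0 (a e) s \<le> norm T powr (s - 1) * a e"
    using assms(2) by (simp add: pow0_def)
qed simp

text \<open>The power with exponent at least 1 takes the role of the summable factor, and the order
  of the product is exchanged if that is the power of \<open>B\<close>.\<close>

lemma trace_op_powers:
  assumes A: "eigenbasis E a A" and B: "eigenbasis F b B"
    and st: "0 \<le> s" "0 \<le> t" "1 \<le> s \<or> 1 \<le> t"
  obtains r where "((\<lambda>(e, f). pow0 (a e) s * pow0 (b f) t * (cmod (cinner e f))\<^sup>2) has_sum r) (E \<times>
    F)"
    "trace_op (op_power A s o\<^sub>L op_power B t) = complex_of_real r"
proof -
  have onb: "is_onb E" "is_onb F" using A B by (auto simp: eigenbasis_def)
  note X = eigenbasis_op_power[OF A st(1)] and Y = eigenbasis_op_power[OF B st(2)]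
  show thesis
  proof (cases "1 \<le> s")
    case True
    show thesis
      by (rule trace_op_diagonal_diagonal[OF onb X Y eigenbasis_power_summable[OF A True]])
        (use that in auto)
  next
    case False
    then have t: "1 \<le> t" using st(3) by simp
    obtain r where r: "((\<lambda>(f, e). pow0 (b f) t * pow0 (a e) s * (cmod (cinner f e))\<^sup>2) has_sum r)
      (F \<times> E)"
      "trace_op (op_power A s o\<^sub>L op_power B t) = complex_of_real r"
      by (rule trace_op_diagonal_diagonal[OF onb(2,1) Y X eigenbasis_power_summable[OF B t]]) auto
    have "((\<lambda>(e, f). pow0 (a e) s * pow0 (b f) t * (cmod (cinner e f))\<^sup>2) has_sum r) (E \<times> F)"
      using r(1) by (subst has_sum_swap) (simp add: mult.commute cmod_cinner_commute)
    then show thesis using r(2) that by blast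
  qed
qed

section \<open>Weighted Young inequalities\<close>

lemma clear_denominator:
  fixes d :: real
  assumes "z \<le> x / d * u + y / d * v" "0 < d"
  shows "d * z \<le> x * u + y * v"
proof -
  have "d * z \<le> d * (x / d * u + y / d * v)" using assms by simp
  also have "\<dots> = x * u + y * v" using assms(2) by (simp add: distrib_left)
  finally show ?thesis .
qed

text \<open>Weighted AM-GM with weights 1 / (1 + \<nu>) and \<nu> / (1 + \<nu>) for c^\<nu>
  x^(1+\<nu>) y^(1-\<nu>) and y^2 / c: the powers of c cancel and the geometric mean is x y. In
  logarithmic variables this is a linear identity of exponents.\<close>

lemma Young_first:
  assumes "0 \<le> \<nu>" "\<nu> \<le> 1" "0 \<le> x" "0 \<le> y" "0 < c"
  shows "(1 + \<nu>) * (pow0 x 1 * pow0 y 1)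
    \<le> c powr \<nu> * (pow0 x (1 + \<nu>) * pow0 y (1 - \<nu>)) + \<nu> / c * (pow0 x 0 * pow0 y 2)"
proof (cases "x = 0 \<or> y = 0")
  case True
  then show ?thesis using assms by (auto simp: pow0_def)
next
  case False
  define p q l where "p = ln x" and "q = ln y" and "l = ln c"
  have ex: "x = exp p" "y = exp q" "c = exp l"
    using False assms by (simp_all add: p_def q_def l_def)
  have "x * y = (exp (\<nu> * l + (1 + \<nu>) * p + (1 - \<nu>) * q)) powr (1 / (1 + \<nu>))
      * (exp (2 * q - l)) powr (\<nu> / (1 + \<nu>))"
  proof -
    have "(\<nu> * l + (1 + \<nu>) * p + (1 - \<nu>) * q) + (2 * q - l) * \<nu> = (1 + \<nu>) * (p + q)"
      by (simp add: algebra_simps)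
    then have "(\<nu> * l + (1 + \<nu>) * p + (1 - \<nu>) * q) * (1 / (1 + \<nu>)) + (2 * q - l) * (\<nu> / (1 + \<nu>))
      = p + q"
      using assms(1) by (simp flip: add_divide_distrib)
    then show ?thesis by (simp only: ex exp_powr_real exp_add[symmetric])
  qed
  also have "\<dots> \<le> 1 / (1 + \<nu>) * exp (\<nu> * l + (1 + \<nu>) * p + (1 - \<nu>) * q) + \<nu> / (1 + \<nu>) * exp (2 * q
    - l)"
    by (rule Youngs_inequality_0) (use assms(1) in \<open>auto simp: field_simps\<close>)
  finally have "(1 + \<nu>) * (x * y)
    \<le> 1 * exp (\<nu> * l + (1 + \<nu>) * p + (1 - \<nu>) * q) + \<nu> * exp (2 * q - l)"
    by (rule clear_denominator) (use assms(1) in simp)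
  moreover have "pow0 y (1 - \<nu>) = exp ((1 - \<nu>) * q)"
    by (simp add: pow0_def ex exp_powr_real mult.commute)
  ultimately show ?thesis
    using assms(1) by (simp add: pow0_def ex exp_powr_real exp_add exp_diff mult_ac)
qed

text \<open>Weighted AM-GM with weights 2\<nu> / (1 + \<nu>) and (1 - \<nu>) / (1 + \<nu>) for (c
  x)^(1+\<nu>) y^(1-\<nu>) and y^2; the geometric mean is (c x)^(2\<nu>) y^(2(1-\<nu>)).\<close>

lemma Young_second:
  assumes "0 \<le> \<nu>" "\<nu> \<le> 1" "0 \<le> x" "0 \<le> y" "0 < c"
  shows "(1 + \<nu>) * c powr (2 * \<nu>) * (pow0 x (2 * \<nu>) * pow0 y (2 * (1 - \<nu>)))
    \<le> 2 * \<nu> * c powr (1 + \<nu>) * (pow0 x (1 + \<nu>) * pow0 y (1 - \<nu>)) + (1 - \<nu>) * (pow0 x 0 * pow0 y 2)"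
proof (cases "x = 0 \<or> y = 0")
  case True
  \<comment> \<open>The endpoints of \<nu> are separate because a zero base with exponent 0
    contributes 1: for \<nu> = 0, x = 0 and for \<nu> = 1, y = 0 the left side need not vanish, and
    equality holds.\<close>
  then show ?thesis using assms by (cases "\<nu> = 0"; cases "\<nu> = 1") (auto simp: pow0_def)
next
  case False
  define p q l where "p = ln x" and "q = ln y" and "l = ln c"
  have ex: "x = exp p" "y = exp q" "c = exp l"
    using False assms by (simp_all add: p_def q_def l_def)
  have pow: "pow0 (exp u) s = exp (s * u)" for u s
    by (simp add: pow0_def exp_powr_real mult.commute)
  have "exp (2 * \<nu> * l + 2 * \<nu> * p + 2 * (1 - \<nu>) * q)
      = (exp ((1 + \<nu>) * l + (1 + \<nu>) * p + (1 - \<nu>) * q)) powr (2 * \<nu> / (1 + \<nu>))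
      * (exp (2 * q)) powr ((1 - \<nu>) / (1 + \<nu>))"
  proof -
    have "((1 + \<nu>) * l + (1 + \<nu>) * p + (1 - \<nu>) * q) * (2 * \<nu>) + 2 * q * (1 - \<nu>)
        = (1 + \<nu>) * (2 * \<nu> * l + 2 * \<nu> * p + 2 * (1 - \<nu>) * q)"
      by (simp add: algebra_simps)
    then have "((1 + \<nu>) * l + (1 + \<nu>) * p + (1 - \<nu>) * q) * (2 * \<nu> / (1 + \<nu>)) + 2 * q * ((1 - \<nu>) /
      (1 + \<nu>))
        = 2 * \<nu> * l + 2 * \<nu> * p + 2 * (1 - \<nu>) * q"
      using nonzero_mult_div_cancel_left[of "1 + \<nu>"] assms(1)
      by (simp only: times_divide_eq_right add_divide_distrib[symmetric])
    then show ?thesis by (simp only: exp_powr_real exp_add[symmetric])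
  qed
  also have "\<dots> \<le> 2 * \<nu> / (1 + \<nu>) * exp ((1 + \<nu>) * l + (1 + \<nu>) * p + (1 - \<nu>) * q)
      + (1 - \<nu>) / (1 + \<nu>) * exp (2 * q)"
    by (rule Youngs_inequality_0) (use assms(1,2) in \<open>auto simp flip: add_divide_distrib\<close>)
  finally have "(1 + \<nu>) * exp (2 * \<nu> * l + 2 * \<nu> * p + 2 * (1 - \<nu>) * q)
      \<le> 2 * \<nu> * exp ((1 + \<nu>) * l + (1 + \<nu>) * p + (1 - \<nu>) * q) + (1 - \<nu>) * exp (2 * q)"
    by (rule clear_denominator) (use assms(1) in simp)
  then show ?thesis
    by (simp add: ex pow exp_powr_real exp_add mult_ac)
qed

text \<open>If c^(1+\<nu>) = m / P, both bounds collapse to multiples of m: c R \<le> m and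
  c^(2\<nu>) Q \<le> m. Multiplying the second by the square of the first gives (m / P)^2 Q R^2
  \<le> m^3. One choice of c serves both inequalities.\<close>

lemma optimize_Young_parameter:
  fixes \<nu> :: real
  assumes \<nu>: "0 \<le> \<nu>" "\<nu> \<le> 1" and nonneg: "0 \<le> m" "0 \<le> P" "0 \<le> Q" "0 \<le> R"
    and first: "\<And>c. c > 0 \<Longrightarrow> (1 + \<nu>) * R \<le> c powr \<nu> * P + \<nu> / c * m"
    and second: "\<And>c. c > 0 \<Longrightarrow>
      (1 + \<nu>) * c powr (2 * \<nu>) * Q \<le> 2 * \<nu> * c powr (1 + \<nu>) * P + (1 - \<nu>) * m"
  shows "Q * R\<^sup>2 \<le> m * P\<^sup>2"
proof -
  \<comment> \<open>\<open>m\<close> or \<open>P\<close> may vanish, and the optimal parameter is a power of \<open>m / P\<close>.\<close>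
  have perturbed: "Q * R\<^sup>2 \<le> (m + \<epsilon>) * (P + \<epsilon>)\<^sup>2" if "\<epsilon> > 0" for \<epsilon>
  proof -
    define m' P' where "m' = m + \<epsilon>" and "P' = P + \<epsilon>"
    have pos: "m' > 0" "P' > 0" using nonneg that by (auto simp: m'_def P'_def)
    have le: "m \<le> m'" "P \<le> P'" using that by (auto simp: m'_def P'_def)
    define c where "c = (m' / P') powr (1 / (1 + \<nu>))"
    have c: "c > 0" using pos by (simp add: c_def)
    have pow: "c powr (1 + \<nu>) = m' / P'"
      using \<nu> pos by (simp add: c_def powr_powr)
    then have pow1: "c * c powr \<nu> = m' / P'"
      using c by (simp add: powr_mult_base)
    have "(1 + \<nu>) * R \<le> c powr \<nu> * P' + \<nu> / c * m'"
    proof -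
      have "c powr \<nu> * P \<le> c powr \<nu> * P'" by (rule mult_left_mono[OF le(2)]) simp
      moreover have "\<nu> / c * m \<le> \<nu> / c * m'" by (rule mult_left_mono[OF le(1)]) (use \<nu> c in simp)
      ultimately show ?thesis using first[OF c] by linarith
    qed
    then have "c * ((1 + \<nu>) * R) \<le> c * (c powr \<nu> * P' + \<nu> / c * m')"
      using c by simp
    also have "\<dots> = (c * c powr \<nu>) * P' + \<nu> * m'" using c by (simp add: distrib_left)
    also have "\<dots> = (1 + \<nu>) * m'" using pos by (simp add: pow1 distrib_right)
    finally have R: "c * R \<le> m'" using \<nu> by (simp add: mult.left_commute)
    have "(1 + \<nu>) * c powr (2 * \<nu>) * Q \<le> 2 * \<nu> * c powr (1 + \<nu>) * P' + (1 - \<nu>) * m'"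
      using second[OF c] mult_left_mono[OF le(2), of "2 * \<nu> * c powr (1 + \<nu>)"]
        mult_left_mono[OF le(1), of "1 - \<nu>"] \<nu> by simp
    also have "\<dots> = (1 + \<nu>) * m'" using pos by (simp add: pow algebra_simps)
    finally have Q: "c powr (2 * \<nu>) * Q \<le> m'" using \<nu> by (simp add: mult.assoc)
    have "(c powr (2 * \<nu>) * Q) * (c * R)\<^sup>2 \<le> m' * m'\<^sup>2"
      using c nonneg pos R Q by (intro mult_mono power_mono) auto
    moreover have "c powr (2 * \<nu>) = (c powr \<nu>)\<^sup>2"
      by (simp add: power2_eq_square flip: powr_add)
    ultimately have "(c * c powr \<nu>)\<^sup>2 * (Q * R\<^sup>2) \<le> m' * m'\<^sup>2"
      by (simp add: power_mult_distrib mult_ac)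
    then show ?thesis
      using pos unfolding pow1 m'_def[symmetric] P'_def[symmetric]
      by (simp add: power_divide field_simps)
  qed
  have lim: "(\<lambda>n. (m + inverse (real (Suc n))) * (P + inverse (real (Suc n)))\<^sup>2) \<longlonglongrightarrow> (m + 0) * (P +
    0)\<^sup>2"
    by (intro tendsto_intros LIMSEQ_inverse_real_of_nat)
  show ?thesis
    using LIMSEQ_le_const[OF lim] perturbed by simp
qed

section \<open>The trace inequality for two positive trace class operators\<close>

theorem theorem3:
  fixes A B :: "'a::complex_hilbert \<Rightarrow>\<^sub>L 'a" and \<nu> :: real
  assumes "positive_op A" and "trace_class A"
    and "positive_op B" and "trace_class B"
    and "0 \<le> \<nu>" and "\<nu> \<le> 1"
  shows "trace_op (op_power B 2) *
           (trace_op (op_power A (1 + \<nu>) o\<^sub>L op_power B (1 - \<nu>)))\<^sup>2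
         \<ge> trace_op (op_power A (2 * \<nu>) o\<^sub>L op_power B (2 * (1 - \<nu>))) *
             (trace_op (A o\<^sub>L B))\<^sup>2"
proof -
  obtain E a where A: "eigenbasis E a A"
    by (rule positive_trace_class_eigenbasis[OF assms(1,2)])
  obtain F b where B: "eigenbasis F b B"
    by (rule positive_trace_class_eigenbasis[OF assms(3,4)])
  have nonneg: "0 \<le> a e" "0 \<le> b f" if "(e, f) \<in> E \<times> F" for e f
    using A B that by (auto simp: eigenbasis_def)
  define w where "w s t = (\<lambda>(e, f). pow0 (a e) s * pow0 (b f) t * (cmod (cinner e f))\<^sup>2)" for s t
  obtain P where P: "(w (1 + \<nu>) (1 - \<nu>) has_sum P) (E \<times> F)"
    "trace_op (op_power A (1 + \<nu>) o\<^sub>L op_power B (1 - \<nu>)) = of_real P"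
    unfolding w_def by (rule trace_op_powers[OF A B, of "1 + \<nu>" "1 - \<nu>"]) (use assms(5,6) in auto)
  obtain Q where Q: "(w (2 * \<nu>) (2 * (1 - \<nu>)) has_sum Q) (E \<times> F)"
    "trace_op (op_power A (2 * \<nu>) o\<^sub>L op_power B (2 * (1 - \<nu>))) = of_real Q"
    unfolding w_def by (rule trace_op_powers[OF A B, of "2 * \<nu>" "2 * (1 - \<nu>)"]) (use assms(5,6) in
      auto)
  obtain R where R: "(w 1 1 has_sum R) (E \<times> F)"
    "trace_op (op_power A 1 o\<^sub>L op_power B 1) = of_real R"
    unfolding w_def by (rule trace_op_powers[OF A B, of 1 1]) auto
  \<comment> \<open>The factor A^0 = I puts Tr[B^2] on the same index set as the other traces; the
    convention for exponent 0 keeps the pairs with a e = 0.\<close>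
  obtain m where m: "(w 0 2 has_sum m) (E \<times> F)"
    "trace_op (op_power A 0 o\<^sub>L op_power B 2) = of_real m"
    unfolding w_def by (rule trace_op_powers[OF A B, of 0 2]) auto
  have w: "0 \<le> w s t x" for s t x by (simp add: w_def case_prod_unfold)
  have "Q * R\<^sup>2 \<le> m * P\<^sup>2"
  proof (rule optimize_Young_parameter[OF assms(5,6)])
    fix c :: real assume c: "c > 0"
    show "(1 + \<nu>) * R \<le> c powr \<nu> * P + \<nu> / c * m"
    proof (rule has_sum_mono)
      show "((\<lambda>x. (1 + \<nu>) * w 1 1 x) has_sum (1 + \<nu>) * R) (E \<times> F)"
        by (intro has_sum_cmult_right R)
      show "((\<lambda>x. c powr \<nu> * w (1 + \<nu>) (1 - \<nu>) x + \<nu> / c * w 0 2 x)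
          has_sum c powr \<nu> * P + \<nu> / c * m) (E \<times> F)"
        by (intro has_sum_add has_sum_cmult_right P m)
      fix x assume "x \<in> E \<times> F"
      then show "(1 + \<nu>) * w 1 1 x \<le> c powr \<nu> * w (1 + \<nu>) (1 - \<nu>) x + \<nu> / c * w 0 2 x"
        using mult_right_mono[OF Young_first[OF assms(5,6) nonneg c], of "fst x" "snd x" "fst x"
          "snd x"
            "(cmod (cinner (fst x) (snd x)))\<^sup>2"]
        by (simp add: w_def case_prod_unfold distrib_right mult.assoc)
    qed
    show "(1 + \<nu>) * c powr (2 * \<nu>) * Q \<le> 2 * \<nu> * c powr (1 + \<nu>) * P + (1 - \<nu>) * m"
    proof (rule has_sum_mono)
      show "((\<lambda>x. (1 + \<nu>) * c powr (2 * \<nu>) * w (2 * \<nu>) (2 * (1 - \<nu>)) x)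
          has_sum (1 + \<nu>) * c powr (2 * \<nu>) * Q) (E \<times> F)"
        by (intro has_sum_cmult_right Q)
      show "((\<lambda>x. 2 * \<nu> * c powr (1 + \<nu>) * w (1 + \<nu>) (1 - \<nu>) x + (1 - \<nu>) * w 0 2 x)
          has_sum 2 * \<nu> * c powr (1 + \<nu>) * P + (1 - \<nu>) * m) (E \<times> F)"
        by (intro has_sum_add has_sum_cmult_right P m)
      fix x assume "x \<in> E \<times> F"
      then show "(1 + \<nu>) * c powr (2 * \<nu>) * w (2 * \<nu>) (2 * (1 - \<nu>)) x
          \<le> 2 * \<nu> * c powr (1 + \<nu>) * w (1 + \<nu>) (1 - \<nu>) x + (1 - \<nu>) * w 0 2 x"
        using mult_right_mono[OF Young_second[OF assms(5,6) nonneg c], of "fst x" "snd x" "fst x"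
          "snd x"
            "(cmod (cinner (fst x) (snd x)))\<^sup>2"]
        by (simp add: w_def case_prod_unfold distrib_right mult.assoc)
    qed
  qed (use P(1) Q(1) R(1) m(1) w in \<open>auto intro: has_sum_nonneg\<close>)
  \<comment> \<open>All traces involved are real, so in the complex order the claim is the real
    inequality together with equality of imaginary parts.\<close>
  then have "complex_of_real (Q * R\<^sup>2) \<le> complex_of_real (m * P\<^sup>2)"
    by (simp only: less_eq_complex_def Re_complex_of_real Im_complex_of_real)
  moreover have "op_power A 0 o\<^sub>L op_power B 2 = op_power B 2"
    by (rule blinfun_eqI) (simp add: op_power_def blinfun_compose.rep_eq)
  ultimately show ?thesis
    using P(2) Q(2) R(2) m(2) by (simp add: eigenbasis_op_power_1[OF A] eigenbasis_op_power_1[OF B])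
qed

end
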